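(* Let $p'\in\mathbb{N}_0$ and let real numbers $a'''_j>0$, $v_j>0$, $w_j\ge v_j+1$ ($j=1,\dots,p'$) be given, such that $a'''_j\,l\ne -v_j-l'$ for all $j=1,\dots,p'$ and $l,l'\in\mathbb{N}_0$. Let $k\in\mathbb{N}$ and let $\omega_j>0$, $\lambda_j>0$ ($j=1,\dots,k$) with $\sum_{l=1}^k\lambda_l<1$. Then $${}_{p'+k}W_{p'}\left[-t\,\Big|\begin{array}{c}(\omega_{k-j+1},\lambda_{k-j+1})_1^k,\,(v_j,a'''_j)_1^{p'}\\(w_j,a'''_j)_1^{p'}\end{array}\right]>0\qquad\text{for every }t>0.$$
   Context: $\mathbb{N}=\{1,2,\dots\}$, $\mathbb{N}_0=\mathbb{N}\cup\{0\}$. The notation $(x_j,X_j)_1^l$ stands for the list $(x_1,X_1),\dots,(x_l,X_l)$ (the empty list if $l=0$); lists separated by commas are concatenated. Thus $(\omega_{k-j+1},\lambda_{k-j+1})_1^k$ is $(\omega_k,\lambda_k),\dots,(\omega_1,\lambda_1)$. Wright generalized hypergeometric function: for $\sum_{j=1}^{q-1}B_j-\sum_{j=1}^pA_j>-1$, $${}_pW_{q-1}\left[-z\,\Big|\begin{array}{c}(\alpha_j,A_j)_1^p\\(\beta_j,B_j)_1^{q-1}\end{array}\right]=H^{1,p}_{p,q}\left[z\,\Big|\begin{array}{c}(1-\alpha_j,A_j)_1^p\\(0,1),(1-\beta_j,B_j)_1^{q-1}\end{array}\right].$$ Fox $H$-function. For $0\le n\le p$, $0\le m\le q$, $A_j,B_j>0$,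 $\alpha_j,\beta_j\in\mathbb{C}$ with $A_j(l+\beta_{j'})\ne B_{j'}(\alpha_j-l'-1)$ for all $1\le j\le n$, $1\le j'\le m$, $l,l'\in\mathbb{N}_0$, put $$\Xi^{m,n}_{p,q}(s)=\frac{\prod_{j=1}^m\Gamma(\beta_j+B_js)\prod_{j=1}^n\Gamma(1-\alpha_j-A_js)}{\prod_{j=m+1}^q\Gamma(1-\beta_j-B_js)\prod_{j=n+1}^p\Gamma(\alpha_j+A_js)}$$ (empty products are $1$), and $$H^{m,n}_{p,q}\left[z\,\Big|\begin{array}{c}(\alpha_j,A_j)_1^p\\(\beta_j,B_j)_1^q\end{array}\right]=\frac{1}{2\pi i}\int_{\mathcal C}\Xi^{m,n}_{p,q}(s)\,z^{-s}\,ds .$$ Let $\chi=\sum_{j=1}^nA_j-\sum_{j=n+1}^pA_j+\sum_{j=1}^mB_j-\sum_{j=m+1}^qB_j$. When $\chi>0$ (as is the case here) and $z>0$, $\mathcal C$ is a contour going from $\gamma-i\infty$ to $\gamma+i\infty$ ($\gamma\in\mathbb{R}$), leaving all poles of $\Gamma(\beta_j+B_js)$, $1\le j\le m$, on its left and all poles of $\Gamma(1-\alpha_j-A_js)$, $1\le j\le n$, on its right; the integral converges and does not depend on the choice of such a contour. *)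

theory Defs
  imports "HOL-Complex_Analysis.Complex_Analysis"
begin

text \<open>
  Parameter lists \<open>(\<alpha>\<^sub>j, A\<^sub>j)\<close> and \<open>(\<beta>\<^sub>j, B\<^sub>j)\<close> are lists of pairs; the list index \<open>j\<close> corresponds
  to the index \<open>j + 1\<close> of the usual notation. The integers \<open>p\<close> and \<open>q\<close> are the lengths of the lists.

  Poles of the Gamma factors in the denominator cause no trouble: in the library \<open>Gamma\<close> is \<open>0\<close> at its
  poles and \<open>x / 0 = 0\<close>, which is the correct value of \<open>1 / \<Gamma>\<close> there.
\<close>
definition fox_Xi :: "nat \<Rightarrow> nat \<Rightarrow> (complex \<times> real) list \<Rightarrow> (complex \<times> real) list \<Rightarrow> complex \<Rightarrow> complex" where
  "fox_Xi m n as bs s =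
     ((\<Prod>j<m. Gamma (fst (bs ! j) + of_real (snd (bs ! j)) * s)) *
      (\<Prod>j<n. Gamma (1 - fst (as ! j) - of_real (snd (as ! j)) * s))) /
     ((\<Prod>j=m..<length bs. Gamma (1 - fst (bs ! j) - of_real (snd (bs ! j)) * s)) *
      (\<Prod>j=n..<length as. Gamma (fst (as ! j) + of_real (snd (as ! j)) * s)))"

definition fox_left_poles :: "nat \<Rightarrow> (complex \<times> real) list \<Rightarrow> complex set" where
  "fox_left_poles m bs =
     {s. \<exists>j<m. fst (bs ! j) + of_real (snd (bs ! j)) * s \<in> \<int>\<^sub>\<le>\<^sub>0}"

definition fox_right_poles :: "nat \<Rightarrow> (complex \<times> real) list \<Rightarrow> complex set" where
  "fox_right_poles n as =
     {s. \<exists>j<n. 1 - fst (as ! j) - of_real (snd (as ! j)) * s \<in> \<int>\<^sub>\<le>\<^sub>0}"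

definition vertical_contour :: "real \<Rightarrow> (real \<Rightarrow> complex) \<Rightarrow> bool" where
  "vertical_contour \<gamma> c \<longleftrightarrow>
     inj c \<and> (\<forall>a b. c piecewise_C1_differentiable_on {a..b}) \<and>
     ((\<lambda>y. Re (c y)) \<longlongrightarrow> \<gamma>) at_bot \<and> ((\<lambda>y. Re (c y)) \<longlongrightarrow> \<gamma>) at_top \<and>
     filterlim (\<lambda>y. Im (c y)) at_bot at_bot \<and> filterlim (\<lambda>y. Im (c y)) at_top at_top"

text \<open>
  A vertical contour cuts the plane into two components; as it is traversed upwards, its left side
  is the component that contains all real numbers close to \<open>-\<infinity>\<close>, its right side the one that
  contains all real numbers close to \<open>\<infinity>\<close>. Points on the contour belong to neither side.
\<close>
definition contour_left :: "(real \<Rightarrow> complex) \<Rightarrow> complex set" where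
  "contour_left c = {s. \<forall>\<^sub>F x in at_bot. connected_component (- range c) s (of_real x)}"

definition contour_right :: "(real \<Rightarrow> complex) \<Rightarrow> complex set" where
  "contour_right c = {s. \<forall>\<^sub>F x in at_top. connected_component (- range c) s (of_real x)}"

definition fox_contour :: "nat \<Rightarrow> nat \<Rightarrow> (complex \<times> real) list \<Rightarrow> (complex \<times> real) list \<Rightarrow> (real \<Rightarrow> complex) \<Rightarrow> bool" where
  "fox_contour m n as bs c \<longleftrightarrow>
     (\<exists>\<gamma>. vertical_contour \<gamma> c) \<and>
     fox_left_poles m bs \<subseteq> contour_left c \<and> fox_right_poles n as \<subseteq> contour_right c"

text \<open>
  The Henstock--Kurzweil integral over the whole parameter line is the improper contour integral.
  The common value over all admissible contours is selected; this is meaningful for \<open>z > 0\<close>,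
  \<open>m \<le> q\<close>, \<open>n \<le> p\<close>, \<open>A\<^sub>j, B\<^sub>j > 0\<close>, disjoint sets of left and right poles, and
  \<open>\<chi> = (\<Sum>j\<le>n. A\<^sub>j) - (\<Sum>j>n. A\<^sub>j) + (\<Sum>j\<le>m. B\<^sub>j) - (\<Sum>j>m. B\<^sub>j) > 0\<close>, in which case the integral
  converges and does not depend on the contour. (For \<open>\<chi> \<le> 0\<close> other contours would be needed.)
\<close>
definition fox_H :: "nat \<Rightarrow> nat \<Rightarrow> (complex \<times> real) list \<Rightarrow> (complex \<times> real) list \<Rightarrow> real \<Rightarrow> complex" where
  "fox_H m n as bs z =
     (THE I. \<exists>c J. fox_contour m n as bs c \<and>
        ((\<lambda>y. fox_Xi m n as bs (c y) * of_real z powr (- c y) * vector_derivative c (at y))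
           has_integral J) UNIV \<and>
        I = J / (2 * of_real pi * \<i>))"

text \<open>
  The Wright function at the point \<open>x = -z < 0\<close>, for \<open>\<Sum>B\<^sub>j - \<Sum>A\<^sub>j > -1\<close>. The underlying \<open>H\<close>
  function has \<open>\<chi> = 1 + \<Sum>A\<^sub>j - \<Sum>B\<^sub>j\<close>, which is to be positive.
\<close>
definition wright_W :: "(complex \<times> real) list \<Rightarrow> (complex \<times> real) list \<Rightarrow> real \<Rightarrow> complex" where
  "wright_W as bs x =
     fox_H 1 (length as)
       (map (\<lambda>(\<alpha>, A). (1 - \<alpha>, A)) as)
       ((0, 1) # map (\<lambda>(\<beta>, B). (1 - \<beta>, B)) bs) (- x)"

end

theory Submission
  imports Defs
begin

text \<open>
  On a vertical line \<open>Re s = \<sigma>\<close> that separates the two families of (real) poles, the integrand is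
  \<open>\<Gamma>(s) t\<^sup>-\<^sup>s\<close> times factors \<open>\<Gamma>(\<omega> - \<lambda> s)\<close> and \<open>\<Gamma>(v - a s) / \<Gamma>(w - a s)\<close>. By Euler's integrals each factor
  is a positive superposition of powers \<open>x\<^sup>-\<^sup>s\<close>, so by Fubini the integral is a positive superposition of
  the Mellin inversion integrals of \<open>\<Gamma>\<close>, that is, of values of \<open>exp (- x)\<close>; hence it is positive.

  Since \<open>fox_H\<close> selects the common value over all admissible contours, the integral along an
  arbitrary one must be shown to agree with that along the line. A long piece of the contour is closed
  up along the line. A pole is joined to a far away real number by a continuum missing the contour;
  it may cross the line, but the closing path can be pushed past the continuum without crossing the
  pole, so the closed path does not wind around any pole and Cauchy's theorem applies.
\<close>

section \<open>Growth in vertical strips\<close>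

text \<open>All estimates rest on one fact: Gamma(s) = O(|Im s|^-2) on vertical strips for large |Im
  s|, while the other Gamma factors and t^-s stay bounded there. Quadratic decay suffices both for
  absolute convergence on the line, as Fubini's theorem requires, and for the vanishing of
  horizontal segments. It comes from the recurrence, which moves a strip into the right half-plane,
  where Euler's integral is dominated by its value at the real part. \<open>strip_bounded\<close>
  looks only at large |Im s|, because all poles are real, and lets both constants depend on the
  strip.

  The obstacle is that a contour may wander far from the line, that its sides are defined by
  connectedness and not by winding numbers, and that infinitely many poles must be cleared by a
  finite truncation. The real part of a contour is bounded by some M, so poles with |x| > M lie
  outside a convex strip containing the closed path. Only finitely many poles remain; their continua
  are compact, so a single height lies beyond all of them.\<close>

definition strip_bounded :: "(complex \<Rightarrow> complex) \<Rightarrow> bool" where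
  "strip_bounded f \<longleftrightarrow>
     (\<forall>a b. \<exists>C Y. \<forall>s. a \<le> Re s \<longrightarrow> Re s \<le> b \<longrightarrow> Y \<le> \<bar>Im s\<bar> \<longrightarrow> norm (f s) \<le> C)"

lemma strip_bounded_mult:
  assumes "strip_bounded f" "strip_bounded g"
  shows "strip_bounded (\<lambda>s. f s * g s)"
  unfolding strip_bounded_def
proof (intro allI)
  fix a b :: real
  obtain C Y where 1: "\<And>s. a \<le> Re s \<Longrightarrow> Re s \<le> b \<Longrightarrow> Y \<le> \<bar>Im s\<bar> \<Longrightarrow> norm (f s) \<le> C"
    using assms(1) unfolding strip_bounded_def by meson
  obtain D Z where 2: "\<And>s. a \<le> Re s \<Longrightarrow> Re s \<le> b \<Longrightarrow> Z \<le> \<bar>Im s\<bar> \<Longrightarrow> norm (g s) \<le> D"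
    using assms(2) unfolding strip_bounded_def by meson
  have "norm (f s * g s) \<le> C * D" if "a \<le> Re s" "Re s \<le> b" "max Y Z \<le> \<bar>Im s\<bar>" for s
    unfolding norm_mult using 1[of s] 2[of s] that
    by (intro mult_mono) (auto intro: order_trans[OF norm_ge_zero])
  then show "\<exists>C Y. \<forall>s. a \<le> Re s \<longrightarrow> Re s \<le> b \<longrightarrow> Y \<le> \<bar>Im s\<bar> \<longrightarrow> norm (f s * g s) \<le> C"
    by blast
qed

lemma strip_bounded_prod:
  "(\<And>i. i \<in> I \<Longrightarrow> strip_bounded (f i)) \<Longrightarrow> strip_bounded (\<lambda>s. \<Prod>i\<in>I. f i s)"
proof (induction I rule: infinite_finite_induct)
  case (insert x F)
  then show ?case by (simp add: strip_bounded_mult)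
qed (auto simp: strip_bounded_def)

text \<open>An affine map with real coefficients carries vertical strips to vertical strips and
  multiplies |Im| by A, which turns the threshold Y into Y / A.\<close>

lemma strip_bounded_affine:
  assumes "strip_bounded f" "A > 0"
  shows "strip_bounded (\<lambda>s. f (of_real \<alpha> - of_real A * s))"
  unfolding strip_bounded_def
proof (intro allI)
  fix a b :: real
  obtain C Y where 1: "\<And>s. \<alpha> - A * b \<le> Re s \<Longrightarrow> Re s \<le> \<alpha> - A * a \<Longrightarrow> Y \<le> \<bar>Im s\<bar> \<Longrightarrow> norm (f s) \<le> C"
    using assms(1) unfolding strip_bounded_def by meson
  have "norm (f (of_real \<alpha> - of_real A * s)) \<le> C" if "a \<le> Re s" "Re s \<le> b" "Y / A \<le> \<bar>Im s\<bar>" for s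
    using that assms(2) by (intro 1) (auto simp: abs_mult field_simps)
  then show "\<exists>C Y. \<forall>s. a \<le> Re s \<longrightarrow> Re s \<le> b \<longrightarrow> Y \<le> \<bar>Im s\<bar> \<longrightarrow> norm (f (of_real \<alpha> - of_real A * s)) \<le> C"
    by blast
qed

lemma strip_bounded_powr:
  assumes "t > 0"
  shows "strip_bounded (\<lambda>s. of_real t powr (- s))"
  unfolding strip_bounded_def
proof (intro allI)
  fix a b :: real
  have "norm (of_real t powr (- s)) \<le> max (t powr (-a)) (t powr (-b))"
    if "a \<le> Re s" "Re s \<le> b" for s :: complex
  proof -
    have "norm (of_real t powr (- s)) = t powr (- Re s)"
      using assms by (subst norm_powr_real_powr) auto
    also have "\<dots> \<le> max (t powr (-a)) (t powr (-b))"
    proof (cases "t \<ge> 1")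
      case True
      then show ?thesis using that by (auto simp: le_max_iff_disj intro!: powr_mono)
    next
      case False
      then show ?thesis using that assms by (auto simp: le_max_iff_disj intro!: powr_mono')
    qed
    finally show ?thesis .
  qed
  then show "\<exists>C Y. \<forall>s. a \<le> Re s \<longrightarrow> Re s \<le> b \<longrightarrow> Y \<le> \<bar>Im s\<bar> \<longrightarrow> norm (complex_of_real t powr (- s)) \<le> C"
    by blast
qed

section \<open>Decay of the Gamma function in strips\<close>

lemma norm_Gamma_le:
  assumes "Re z > 0"
  shows "norm (Gamma z) \<le> Gamma (Re z)"
proof -
  have "norm (integral {0..} (\<lambda>t. of_real t powr (z - 1) / of_real (exp t)))
      \<le> integral {0..} (\<lambda>t. t powr (Re z - 1) / exp t)"
    using Gamma_integral_complex[OF assms] Gamma_integral_real[OF assms]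
    by (intro integral_norm_bound_integral)
       (auto simp: has_integral_iff norm_divide norm_powr_real_powr norm_exp_eq_Re)
  then show ?thesis
    using Gamma_integral_complex[OF assms] Gamma_integral_real[OF assms]
    by (simp add: has_integral_iff)
qed

text \<open>All factors s + i have the imaginary part of s. The case m = 2 yields quadratic decay; m
  = 0 yields the lower bound 1 that allows division.\<close>

lemma pochhammer_norm_ge:
  fixes s :: complex
  assumes "\<bar>Im s\<bar> \<ge> 1" "n \<ge> m"
  shows "\<bar>Im s\<bar> ^ m \<le> norm (pochhammer s n)"
proof -
  have "\<bar>Im s\<bar> ^ m \<le> \<bar>Im s\<bar> ^ n"
    using assms by (intro power_increasing) auto
  also have "\<dots> = (\<Prod>i\<in>{0..<n}. \<bar>Im s\<bar>)" by simp
  also have "\<dots> \<le> (\<Prod>i\<in>{0..<n}. norm (s + of_nat i))"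
    by (intro prod_mono) (use abs_Im_le_cmod[of "s + of_nat _"] in auto)
  also have "\<dots> = norm (pochhammer s n)"
    by (simp add: pochhammer_prod prod_norm)
  finally show ?thesis .
qed

lemma notin_nonpos_Ints_Im: "Im s \<noteq> 0 \<Longrightarrow> s \<notin> \<int>\<^sub>\<le>\<^sub>0"
  by (auto elim!: nonpos_Ints_cases)

lemma Gamma_real_bounded_Icc:
  fixes a b :: real
  assumes "a > 0"
  obtains C where "\<And>x. x \<in> {a..b} \<Longrightarrow> Gamma x \<le> C"
proof -
  have "compact (Gamma ` {a..b})"
    using assms by (intro compact_continuous_image continuous_intros) (auto elim!: nonpos_Ints_cases)
  then have "bounded (Gamma ` {a..b})" by (rule compact_imp_bounded)
  then obtain C where "\<forall>y\<in>Gamma ` {a..b}. norm y \<le> C" unfolding bounded_iff by blast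
  then show ?thesis by (intro that[of C]) (fastforce dest: abs_le_D1)
qed

text \<open>Gamma(s) is Gamma(s + n) divided by the Pochhammer symbol: for large n the numerator is
  bounded by the real Gamma function on a compact interval, and the denominator has at least two
  factors of modulus at least |Im s|.\<close>

lemma strip_bounded_Im_sq_Gamma: "strip_bounded (\<lambda>s. of_real ((Im s)\<^sup>2) * Gamma s)"
  unfolding strip_bounded_def
proof (intro allI)
  fix a b :: real
  \<comment> \<open>The ceiling moves the strip into Re s >= 1; the extra 2 guarantees two factors
    even when a is large.\<close>
  define n where "n = nat \<lceil>1 - a\<rceil> + 2"
  have n: "a + real n \<ge> 1" "n \<ge> 2" unfolding n_def by linarith+
  obtain C where C: "\<And>x. x \<in> {a + n..b + n} \<Longrightarrow> Gamma x \<le> C"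
    using Gamma_real_bounded_Icc[of "a + n" "b + n"] n by auto
  have "norm (of_real ((Im s)\<^sup>2) * Gamma s) \<le> C" if "a \<le> Re s" "Re s \<le> b" "1 \<le> \<bar>Im s\<bar>" for s
  proof -
    have "s \<notin> \<int>\<^sub>\<le>\<^sub>0" using that(3) by (intro notin_nonpos_Ints_Im) auto
    then have "pochhammer s n * Gamma s = Gamma (s + of_nat n)"
      by (simp add: pochhammer_Gamma Gamma_eq_zero_iff)
    then have "norm (pochhammer s n) * norm (Gamma s) \<le> Gamma (Re s + n)"
      using norm_Gamma_le[of "s + of_nat n"] n that by (simp flip: norm_mult)
    also have "\<dots> \<le> C" using that by (intro C) auto
    finally have "norm (pochhammer s n) * norm (Gamma s) \<le> C" .
    moreover have "(Im s)\<^sup>2 * norm (Gamma s) \<le> norm (pochhammer s n) * norm (Gamma s)"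
      using pochhammer_norm_ge[of s 2 n] that n by (intro mult_right_mono) auto
    ultimately show ?thesis by (simp add: norm_mult norm_power)
  qed
  then show "\<exists>C Y. \<forall>s. a \<le> Re s \<longrightarrow> Re s \<le> b \<longrightarrow> Y \<le> \<bar>Im s\<bar> \<longrightarrow>
      norm (of_real ((Im s)\<^sup>2) * Gamma s) \<le> C" by blast
qed

lemma strip_bounded_Im_sqD:
  assumes "strip_bounded (\<lambda>s. of_real ((Im s)\<^sup>2) * f s)"
  shows "strip_bounded f"
  unfolding strip_bounded_def
proof (intro allI)
  fix a b :: real
  obtain C Y where 1: "\<And>s. a \<le> Re s \<Longrightarrow> Re s \<le> b \<Longrightarrow> Y \<le> \<bar>Im s\<bar> \<Longrightarrow>
      norm (of_real ((Im s)\<^sup>2) * f s) \<le> C"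
    using assms unfolding strip_bounded_def by meson
  have "norm (f s) \<le> C" if "a \<le> Re s" "Re s \<le> b" "max Y 1 \<le> \<bar>Im s\<bar>" for s
  proof -
    have "1 * norm (f s) \<le> (Im s)\<^sup>2 * norm (f s)"
      using that power_mono[of 1 "\<bar>Im s\<bar>" 2] by (intro mult_right_mono) auto
    then show ?thesis using 1[of s] that by (simp add: norm_mult norm_power)
  qed
  then show "\<exists>C Y. \<forall>s. a \<le> Re s \<longrightarrow> Re s \<le> b \<longrightarrow> Y \<le> \<bar>Im s\<bar> \<longrightarrow> norm (f s) \<le> C" by blast
qed

section \<open>Euler's integrals\<close>

lemma powr_of_real_pos: "x > 0 \<Longrightarrow> complex_of_real x powr z = exp (z * of_real (ln x))"
  by (simp add: powr_def Ln_of_real)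

text \<open>Writing t^(z - 1) e^-t as a single exponential in ln t, cut off by an indicator on all
  of \<open>lborel\<close>, makes the integrand visibly measurable and ready for Fubini's
  theorem.\<close>

lemma has_bochner_integral_Gamma:
  assumes "Re z > 0"
  shows "has_bochner_integral lborel
           (\<lambda>t. indicator {0<..} t *\<^sub>R exp ((z - 1) * of_real (ln t) - of_real t)) (Gamma z)"
    (is "has_bochner_integral _ ?f _")
proof -
  have eq: "?f = (\<lambda>t. indicator {0<..} t *\<^sub>R (complex_of_real t powr (z - 1) / of_real (exp t)))"
    by (auto simp: fun_eq_iff indicator_def powr_of_real_pos exp_diff simp flip: exp_of_real)
  have meas: "?f \<in> borel_measurable borel" by measurable
  have "integrable lebesgue ?f"
    using absolutely_integrable_Gamma_integral'[OF assms] unfolding eq set_integrable_def .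
  then have int: "integrable lborel ?f"
    using meas by (subst (asm) integrable_completion) auto
  have "(?f has_integral Gamma z) UNIV"
  proof -
    have "((\<lambda>t. if t \<in> {0<..} then complex_of_real t powr (z - 1) / of_real (exp t) else 0) has_integral Gamma z) UNIV"
      using Gamma_integral_complex'[OF assms] by (subst has_integral_restrict_UNIV)
    also have "(\<lambda>t. if t \<in> {0<..} then complex_of_real t powr (z - 1) / of_real (exp t) else 0) = ?f"
      unfolding eq by (auto simp: indicator_def)
    finally show ?thesis .
  qed
  with has_integral_integral_lborel[OF int] have "integral\<^sup>L lborel ?f = Gamma z"
    by (rule has_integral_unique)
  with int show ?thesis by (simp add: has_bochner_integral_iff)
qed

text \<open>The translation by t in Euler's integral for Gamma(d). It is the inner integral when the
  product Gamma(z) Gamma(d) is written with the sum u of the two integration variables.\<close>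

lemma has_bochner_integral_Gamma_shift:
  fixes d t :: real
  assumes "d > 0"
  shows "has_bochner_integral lborel
           (\<lambda>u. indicator {t<..} u * exp ((d - 1) * ln (u - t) - u)) (exp (- t) * Gamma d)"
proof -
  have "has_bochner_integral lborel (\<lambda>u. Re (indicator {0<..} u *\<^sub>R
      exp ((of_real d - 1) * of_real (ln u) - of_real u))) (Re (Gamma (of_real d)))"
    using has_bochner_integral_Gamma[of "of_real d"] assms by (intro has_bochner_integral_Re) auto
  also have "Re (Gamma (of_real d)) = Gamma d" by (simp add: Gamma_complex_of_real)
  also have "(\<lambda>u. Re (indicator {0<..} u *\<^sub>R exp ((of_real d - 1) * of_real (ln u) - of_real u))) =
     (\<lambda>u. indicator {0<..} u * exp ((d - 1) * ln u - u))"
    by (auto simp: fun_eq_iff Re_exp)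
  finally have "has_bochner_integral lborel (\<lambda>u. indicator {0<..} u * exp ((d - 1) * ln u - u)) (Gamma d)" .
  then have "has_bochner_integral lborel (\<lambda>u. exp (- t) * (indicator {0<..} u * exp ((d - 1) * ln u - u))) (exp (-t) * Gamma d)"
    by (intro has_bochner_integral_mult_right) auto
  then have "has_bochner_integral lborel (\<lambda>u. exp (- t) * (indicator {0<..} (- t + 1 * u) *
       exp ((d - 1) * ln (- t + 1 * u) - (- t + 1 * u)))) (exp (-t) * Gamma d)"
    by (subst (asm) lborel_has_bochner_integral_real_affine_iff[of 1 _ _ "- t"]) auto
  also have "(\<lambda>u. exp (- t) * (indicator {0<..} (- t + 1 * u) *
       exp ((d - 1) * ln (- t + 1 * u) - (- t + 1 * u)))) =
     (\<lambda>u. indicator {t<..} u * exp ((d - 1) * ln (u - t) - u))"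
    by (auto simp: fun_eq_iff indicator_def algebra_simps simp flip: exp_add)
  finally show ?thesis .
qed

text \<open>The library has this only for real \<open>z\<close>.\<close>
lemma has_bochner_integral_Beta:
  fixes z :: complex and d :: real
  assumes z: "Re z > 0" and d: "d > 0"
  shows "has_bochner_integral lborel
           (\<lambda>u. indicator {0<..<1} u *\<^sub>R exp ((z - 1) * of_real (ln u) + of_real ((d - 1) * ln (1 - u))))
           (of_real (Gamma d) * Gamma z * rGamma (z + of_real d))"
    (is "has_bochner_integral _ ?b _")
proof -
  define G where "G = (\<lambda>z t. indicator {0<..} t *\<^sub>R exp ((z - 1) * of_real (ln t) - of_real t :: complex))"
  \<comment> \<open>The integrand of Gamma(z) Gamma(d) in the coordinates t and u, with u the sum of
    the two original variables; it lives on 0 < t < u. Integrating over u first gives Gamma(z)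
    Gamma(d), over t first Gamma(z + d) times the Beta integral.\<close>
  define f where "f = (\<lambda>t u. indicator {0<..} t *\<^sub>R exp ((z - 1) * of_real (ln t)) *
      of_real (indicator {t<..} u * exp ((d - 1) * ln (u - t) - u)))"
  have f_int: "has_bochner_integral lborel (f t) (G z t * of_real (Gamma d))" for t
  proof -
    have "has_bochner_integral lborel (f t) (indicator {0<..} t *\<^sub>R exp ((z - 1) * of_real (ln t)) *
        of_real (exp (-t) * Gamma d))"
      unfolding f_def
      by (intro has_bochner_integral_mult_right has_bochner_integral_of_real
          has_bochner_integral_Gamma_shift d)
    also have "indicator {0<..} t *\<^sub>R exp ((z - 1) * of_real (ln t)) *
        of_real (exp (-t) * Gamma d) = G z t * of_real (Gamma d)"
      by (auto simp: G_def exp_add exp_diff exp_minus field_simps simp flip: exp_of_real)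
    finally show ?thesis .
  qed
  have nf_int: "has_bochner_integral lborel (\<lambda>u. norm (f t u)) (norm (G z t) * Gamma d)" for t
  proof -
    have "has_bochner_integral lborel (\<lambda>u. norm (indicator {0<..} t *\<^sub>R exp ((z - 1) * of_real (ln t))) *
       (indicator {t<..} u * exp ((d - 1) * ln (u - t) - u)))
       (norm (indicator {0<..} t *\<^sub>R exp ((z - 1) * of_real (ln t))) * (exp (- t) * Gamma d))"
      by (intro has_bochner_integral_mult_right has_bochner_integral_of_real
          has_bochner_integral_Gamma_shift d)
    also have "norm (indicator {0<..} t *\<^sub>R exp ((z - 1) * of_real (ln t))) * (exp (- t) * Gamma d)
       = norm (G z t) * Gamma d"
      by (auto simp: G_def indicator_def norm_exp_eq_Re exp_diff[of _ t] exp_minus divide_simps)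
    finally show ?thesis by (simp add: f_def norm_mult mult.assoc)
  qed
  have GI: "has_bochner_integral lborel (G z) (Gamma z)" if "Re z > 0" for z
    unfolding G_def using that by (rule has_bochner_integral_Gamma)
  have pair: "integrable (lborel \<Otimes>\<^sub>M lborel) (\<lambda>(t, u). f t u)"
  proof (rule lborel_pair.Fubini_integrable)
    show "(\<lambda>(t, u). f t u) \<in> borel_measurable (lborel \<Otimes>\<^sub>M lborel)"
    proof -
      have "(\<lambda>(t, u). f t u) \<in> borel_measurable (borel \<Otimes>\<^sub>M borel)"
        unfolding f_def indicator_def greaterThan_iff by measurable
      then show ?thesis by (simp cong: measurable_cong_sets)
    qed
    have "(\<lambda>t. \<integral>u. norm (case (t, u) of (t, u) \<Rightarrow> f t u) \<partial>lborel) = (\<lambda>t. norm (G z t) * Gamma d)"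
      using nf_int by (simp add: has_bochner_integral_iff)
    then show "integrable lborel (\<lambda>t. \<integral>u. norm (case (t, u) of (t, u) \<Rightarrow> f t u) \<partial>lborel)"
      using GI[OF z] by (auto simp: has_bochner_integral_iff)
    show "AE t in lborel. integrable lborel (\<lambda>u. case (t, u) of (t, u) \<Rightarrow> f t u)"
      using f_int by (auto simp: has_bochner_integral_iff)
  qed
  define B where "B = integral\<^sup>L lborel ?b"
  \<comment> \<open>The substitution t = u x separates the variables: the powers u^(z - 1) and u^(d
    - 1) give the exponent z + d - 2, and the Jacobian u raises it to the z + d - 1 of
    \<open>G (z + of_real d)\<close>.\<close>
  have inner: "(\<integral>t. f t u \<partial>lborel) = G (z + of_real d) u * B" for u
  proof (cases "u > 0")
    case True
    have "(\<integral>t. f t u \<partial>lborel) = u *\<^sub>R (\<integral>x. f (0 + u * x) u \<partial>lborel)"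
      using lborel_integral_real_affine[of u "\<lambda>t. f t u" 0] True by simp
    also have "(\<lambda>x. f (0 + u * x) u) =
        (\<lambda>x. exp ((z + of_real d - 2) * of_real (ln u) - of_real u) * ?b x)"
    proof
      fix x :: real
      show "f (0 + u * x) u = exp ((z + of_real d - 2) * of_real (ln u) - of_real u) * ?b x"
      proof (cases "0 < x \<and> x < 1")
        case x: True
        have "u - u * x = u * (1 - x)" by (simp add: algebra_simps)
        then have l: "ln (u - u * x) = ln u + ln (1 - x)" "ln (u * x) = ln u + ln x"
          using x True by (simp_all add: ln_mult)
        have "f (0 + u * x) u = exp ((z - 1) * of_real (ln (u * x)) + of_real ((d - 1) * ln (u - u * x) - u))"
          using x True by (simp add: f_def exp_add flip: exp_of_real)
        also have "\<dots> = exp ((z + of_real d - 2) * of_real (ln u) - of_real u +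
            ((z - 1) * of_real (ln x) + of_real ((d - 1) * ln (1 - x))))"
          unfolding l by (simp add: algebra_simps)
        finally show ?thesis using x by (simp add: exp_add)
      next
        case False
        then have "\<not> (0 < u * x \<and> u * x < u)" using True by (auto simp: zero_less_mult_iff)
        then show ?thesis using False by (auto simp: f_def indicator_def)
      qed
    qed
    also have "u *\<^sub>R (\<integral>x. exp ((z + of_real d - 2) * of_real (ln u) - of_real u) * ?b x \<partial>lborel)
       = of_real u * exp ((z + of_real d - 2) * of_real (ln u) - of_real u) * B"
      by (simp add: B_def scaleR_conv_of_real)
    also have "of_real u * exp ((z + of_real d - 2) * of_real (ln u) - of_real u) =
       exp (of_real (ln u) :: complex) * exp ((z + of_real d - 2) * of_real (ln u) - of_real u)"
      using True by (subst exp_of_real) simp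
    also have "exp (of_real (ln u) :: complex) * exp ((z + of_real d - 2) * of_real (ln u) - of_real u) =
       G (z + of_real d) u"
      unfolding G_def exp_add[symmetric] using True by (auto simp: algebra_simps)
    finally show ?thesis .
  next
    case False
    then have "f t u = 0" for t by (auto simp: f_def indicator_def)
    then show ?thesis using False by (simp add: G_def)
  qed
  have "Gamma (z + of_real d) * B = (\<integral>u. (\<integral>t. f t u \<partial>lborel) \<partial>lborel)"
    unfolding inner using GI[of "z + of_real d"] z d by (simp add: has_bochner_integral_iff)
  also have "\<dots> = (\<integral>t. (\<integral>u. f t u \<partial>lborel) \<partial>lborel)"
    by (rule lborel_pair.Fubini_integral[OF pair])
  also have "\<dots> = Gamma z * of_real (Gamma d)"
    using f_int GI[OF z] by (simp add: has_bochner_integral_iff)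
  finally have eq: "Gamma (z + of_real d) * B = Gamma z * of_real (Gamma d)" .
  have "z + of_real d \<notin> \<int>\<^sub>\<le>\<^sub>0" using z d by (auto elim!: nonpos_Ints_cases simp: complex_eq_iff)
  then have B: "B = of_real (Gamma d) * Gamma z * rGamma (z + of_real d)"
    using eq by (simp add: rGamma_inverse_Gamma field_simps Gamma_eq_zero_iff)
  \<comment> \<open>The value of \<open>B\<close> says nothing about integrability, since a
    non-integrable function has integral 0. So this is proved separately, by comparison with the
    real Beta integrand at Re z.\<close>
  have "integrable lborel ?b"
  proof (rule Bochner_Integration.integrable_bound)
    define r where "r = (\<lambda>x. indicator {0<..<1} x * (x powr (Re z - 1) * (1 - x) powr (d - 1)) :: real)"
    have "(r has_integral Beta (Re z) d) UNIV"
    proof -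
      have "((\<lambda>x. x powr (Re z - 1) * (1 - x) powr (d - 1)) has_integral Beta (Re z) d) {0<..<1}"
        using has_integral_Beta_real[OF z d] by (simp add: has_integral_Icc_iff_Ioo)
      then have "((\<lambda>x. if x \<in> {0<..<1} then x powr (Re z - 1) * (1 - x) powr (d - 1) else 0) has_integral Beta (Re z) d) UNIV"
        by (subst has_integral_restrict_UNIV)
      also have "(\<lambda>x. if x \<in> {0<..<1} then x powr (Re z - 1) * (1 - x) powr (d - 1) else 0) = r"
        by (auto simp: r_def indicator_def)
      finally show ?thesis .
    qed
    then have "r absolutely_integrable_on UNIV"
      by (intro nonnegative_absolutely_integrable_1) (auto simp: r_def indicator_def)
    then show "integrable lborel r"
      unfolding set_integrable_def by (subst (asm) integrable_completion) (auto simp: r_def)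
    show "AE x in lborel. norm (?b x) \<le> norm (r x)"
      by (intro AE_I2) (auto simp: r_def indicator_def powr_def simp flip: exp_add)
  qed auto
  then show ?thesis using B by (simp add: has_bochner_integral_iff B_def)
qed

section \<open>Integrals along vertical lines\<close>

lemma strip_decay:
  assumes "strip_bounded (\<lambda>s. of_real ((Im s)\<^sup>2) * f s)" "e > 0"
  shows "\<exists>Y. \<forall>s. a \<le> Re s \<longrightarrow> Re s \<le> b \<longrightarrow> Y \<le> \<bar>Im s\<bar> \<longrightarrow> norm (f s) \<le> e"
proof -
  obtain C Y where C: "\<And>s. a \<le> Re s \<Longrightarrow> Re s \<le> b \<Longrightarrow> Y \<le> \<bar>Im s\<bar> \<Longrightarrow>
      norm (of_real ((Im s)\<^sup>2) * f s) \<le> C"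
    using assms(1) unfolding strip_bounded_def by meson
  have "norm (f s) \<le> e" if s: "a \<le> Re s" "Re s \<le> b" "max Y (max 1 (C / e)) \<le> \<bar>Im s\<bar>" for s
  proof -
    have "C / e \<le> \<bar>Im s\<bar> * 1" using s by simp
    also have "\<dots> \<le> \<bar>Im s\<bar> * \<bar>Im s\<bar>" using s by (intro mult_left_mono) auto
    finally have "C / e \<le> (Im s)\<^sup>2" by (simp add: power2_eq_square)
    then have "C \<le> (Im s)\<^sup>2 * e" using assms(2) by (simp add: field_simps)
    moreover have "(Im s)\<^sup>2 * norm (f s) \<le> C" using C[of s] s by (simp add: norm_mult norm_power)
    ultimately have "(Im s)\<^sup>2 * norm (f s) \<le> (Im s)\<^sup>2 * e" by linarith
    moreover have "(Im s)\<^sup>2 > 0" using s by auto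
    ultimately show ?thesis by simp
  qed
  then show ?thesis by blast
qed

lemma integrable_inverse_square_plus_one: "integrable lborel (\<lambda>y::real. 1 / (1 + y\<^sup>2))"
proof -
  have "(\<integral>\<^sup>+y. ennreal (1 / (1 + y\<^sup>2)) * indicator {0..} y \<partial>lborel) = ennreal (pi / 2 - arctan 0)"
    by (rule nn_integral_FTC_atLeast)
       (auto intro!: derivative_eq_intros tendsto_arctan_at_top simp: inverse_eq_divide)
  also have "(\<lambda>y. ennreal (1 / (1 + y\<^sup>2)) * indicator {0..} y) =
      (\<lambda>y. ennreal (indicator {0..} y *\<^sub>R (1 / (1 + y\<^sup>2))))"
    by (auto simp: indicator_def)
  finally have "has_bochner_integral lborel (\<lambda>y::real. indicator {0..} y *\<^sub>R (1 / (1 + y\<^sup>2))) (pi / 2)"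
    by (intro has_bochner_integral_nn_integral)
       (auto intro!: AE_I2)
  from has_bochner_integral_even_function[OF this] show ?thesis
    by (simp add: has_bochner_integral_iff)
qed

lemma integrable_vertical_line:
  assumes "strip_bounded (\<lambda>s. of_real ((Im s)\<^sup>2) * f s)"
    and cont: "continuous_on UNIV (\<lambda>y. f (Complex \<sigma> y))"
  shows "integrable lborel (\<lambda>y. f (Complex \<sigma> y))"
proof -
  obtain C Y where C: "\<And>s. \<sigma> \<le> Re s \<Longrightarrow> Re s \<le> \<sigma> \<Longrightarrow> Y \<le> \<bar>Im s\<bar> \<Longrightarrow>
      norm (of_real ((Im s)\<^sup>2) * f s) \<le> C"
    using assms(1) unfolding strip_bounded_def by meson
  define Z where "Z = max Y 1"
  have "compact ((\<lambda>y. (1 + y\<^sup>2) *\<^sub>R f (Complex \<sigma> y)) ` {-Z..Z})"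
    by (intro compact_continuous_image continuous_intros continuous_on_subset[OF cont]) auto
  then have "bounded ((\<lambda>y. (1 + y\<^sup>2) *\<^sub>R f (Complex \<sigma> y)) ` {-Z..Z})"
    by (rule compact_imp_bounded)
  then obtain B where B: "\<And>y. y \<in> {-Z..Z} \<Longrightarrow> norm ((1 + y\<^sup>2) *\<^sub>R f (Complex \<sigma> y)) \<le> B"
    unfolding bounded_iff by blast
  \<comment> \<open>On [-Z, Z] compactness gives B; beyond it |y| >= 1 gives 1 + y^2 <= 2 y^2, hence
    the factor 2.\<close>
  define D where "D = max B (2 * C)"
  have D: "norm (f (Complex \<sigma> y)) \<le> D * (1 / (1 + y\<^sup>2))" for y
  proof -
    have "(1 + y\<^sup>2) * norm (f (Complex \<sigma> y)) \<le> D"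
    proof (cases "y \<in> {-Z..Z}")
      case True
      moreover have "\<bar>1 + y\<^sup>2\<bar> = 1 + y\<^sup>2" by (intro abs_of_nonneg) simp
      ultimately show ?thesis using B[of y] by (simp add: D_def)
    next
      case False
      then have y: "\<bar>y\<bar> \<ge> Y" "\<bar>y\<bar> \<ge> 1" by (auto simp: Z_def)
      have "1 \<le> y\<^sup>2" using power_mono[OF y(2), of 2] by simp
      then have "(1 + y\<^sup>2) * norm (f (Complex \<sigma> y)) \<le> (2 * y\<^sup>2) * norm (f (Complex \<sigma> y))"
        by (intro mult_right_mono) auto
      moreover have "y\<^sup>2 * norm (f (Complex \<sigma> y)) \<le> C"
        using C[of "Complex \<sigma> y"] y by (simp add: norm_mult norm_power)
      ultimately show ?thesis by (simp add: D_def)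
    qed
    moreover have "1 + y\<^sup>2 > 0" by (simp add: add_pos_nonneg)
    ultimately show ?thesis by (simp add: field_simps)
  qed
  have "integrable lborel (\<lambda>y. D * (1 / (1 + y\<^sup>2)))"
    by (intro integrable_mult_right integrable_inverse_square_plus_one)
  then show ?thesis
  proof (rule Bochner_Integration.integrable_bound)
    show "(\<lambda>y. f (Complex \<sigma> y)) \<in> borel_measurable lborel"
      using borel_measurable_continuous_onI[OF cont] by simp
    show "AE y in lborel. norm (f (Complex \<sigma> y)) \<le> norm (D * (1 / (1 + y\<^sup>2)))"
      unfolding real_norm_def by (intro AE_I2 order_trans[OF D abs_ge_self])
  qed
qed

lemma continuous_on_vertical_line:
  assumes "f holomorphic_on S" "\<And>y. Complex \<sigma> y \<in> S"
  shows "continuous_on UNIV (\<lambda>y. f (Complex \<sigma> y))"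
proof -
  have "continuous_on UNIV (\<lambda>y. Complex \<sigma> y)"
    by (auto simp: Complex_eq intro!: continuous_intros)
  then show ?thesis
    by (rule continuous_on_compose2[OF holomorphic_on_imp_continuous_on[OF assms(1)]]) (use assms(2) in auto)
qed

lemma horizontal_segment_integral:
  assumes cont: "continuous_on (closed_segment x y) f"
    and bound: "\<And>z. z \<in> closed_segment x y \<Longrightarrow> norm (f z) \<le> e"
    and xy: "Im x = Im y" "\<bar>Re y - Re x\<bar> \<le> d"
  obtains z where "(f has_contour_integral z) (linepath x y)" "norm z \<le> e * d"
proof -
  have int: "f contour_integrable_on (linepath x y)"
    using cont by (rule contour_integrable_continuous_linepath)
  have e: "0 \<le> e"
    using bound[of x] norm_ge_zero[of "f x"] by (meson ends_in_segment(1) order_trans)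
  have "norm (contour_integral (linepath x y) f) \<le> e * norm (y - x)"
    using int e bound by (rule contour_integral_bound_linepath)
  also have "norm (y - x) = \<bar>Re y - Re x\<bar>"
    using xy(1) by (simp add: cmod_eq_Re)
  also have "e * \<dots> \<le> e * d"
    using xy(2) e by (rule mult_left_mono)
  finally show ?thesis
    by (rule that[OF has_contour_integral_integral[OF int]])
qed

text \<open>The residue theorem on a rectangle with vertical sides at \<tau> and \<sigma>: as its
  height grows, the horizontal sides disappear and the vertical ones give i I - i J. Division by i
  leaves 2 \<pi> where 2 \<pi> i is customary.\<close>

lemma vertical_line_integral_diff:
  assumes S: "open S" "connected S" "\<And>s. \<tau> \<le> Re s \<Longrightarrow> Re s \<le> \<sigma> \<Longrightarrow> s \<in> S"
    and \<tau>\<sigma>: "\<tau> < \<sigma>"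
    and pts: "finite pts" "\<And>p. p \<in> pts \<Longrightarrow> \<tau> < Re p \<and> Re p < \<sigma>"
    and holo: "f holomorphic_on S - pts"
    and decay: "\<And>e. e > 0 \<Longrightarrow> \<exists>Y. \<forall>s. \<tau> \<le> Re s \<longrightarrow> Re s \<le> \<sigma> \<longrightarrow> Y \<le> \<bar>Im s\<bar> \<longrightarrow> norm (f s) \<le> e"
    and I: "((\<lambda>y. f (Complex \<sigma> y)) has_integral I) UNIV"
    and J: "((\<lambda>y. f (Complex \<tau> y)) has_integral J) UNIV"
  shows "I - J = 2 * pi * (\<Sum>p\<in>pts. residue f p)"
proof -
  define T where "T = 2 * pi * (\<Sum>p\<in>pts. residue f p)"
  have "bounded pts" using pts(1) by (rule finite_imp_bounded)
  then obtain N where N: "\<And>p. p \<in> pts \<Longrightarrow> norm p \<le> N" unfolding bounded_iff by blast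
  have "norm (I - J - T) \<le> e" if e: "e > 0" for e
  proof -
    \<comment> \<open>Two truncated vertical integrals contribute e' each, two horizontal sides of
      length \<sigma> - \<tau> contribute e' (\<sigma> - \<tau>) each.\<close>
    define e' where "e' = e / (2 + 2 * (\<sigma> - \<tau>))"
    have "2 + 2 * (\<sigma> - \<tau>) > 0" using \<tau>\<sigma> by simp
    then have e': "e' > 0" "e' * (2 + 2 * (\<sigma> - \<tau>)) = e"
      using e by (auto simp: e'_def)
    have e'2: "2 * e' + 2 * (e' * (\<sigma> - \<tau>)) = e"
      using e'(2) by (simp add: algebra_simps)
    obtain B where B: "\<And>a b. ball 0 B \<subseteq> cbox a b \<Longrightarrow>
        \<exists>z. ((\<lambda>y. f (Complex \<sigma> y)) has_integral z) (cbox a b) \<and> norm (z - I) < e'"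
      using I e'(1) unfolding has_integral'[of _ I UNIV] by (simp only: UNIV_I if_True) blast
    obtain D where D: "\<And>a b. ball 0 D \<subseteq> cbox a b \<Longrightarrow>
        \<exists>z. ((\<lambda>y. f (Complex \<tau> y)) has_integral z) (cbox a b) \<and> norm (z - J) < e'"
      using J e'(1) unfolding has_integral'[of _ J UNIV] by (simp only: UNIV_I if_True) blast
    obtain Y where Y: "\<And>s. \<tau> \<le> Re s \<Longrightarrow> Re s \<le> \<sigma> \<Longrightarrow> Y \<le> \<bar>Im s\<bar> \<Longrightarrow> norm (f s) \<le> e'"
      using decay[OF e'(1)] by blast
    \<comment> \<open>Beyond both truncation thresholds, the decay threshold and the modulus of
      every pole, so the rectangle encloses all of \<open>pts\<close>.\<close>
    define R where "R = max (max B D) (max Y (max N 0)) + 1"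
    have R: "R > B" "R > D" "R > Y" "R > N" "R > 0" by (auto simp: R_def)
    have "ball 0 B \<subseteq> cbox (-R) R" using R by auto
    from B[OF this] obtain z1 where z1: "((\<lambda>y. f (Complex \<sigma> y)) has_integral z1) {-R..R}" "norm (z1 - I) < e'"
      by auto
    have "ball 0 D \<subseteq> cbox (-R) R" using R by auto
    from D[OF this] obtain z2 where z2: "((\<lambda>y. f (Complex \<tau> y)) has_integral z2) {-R..R}" "norm (z2 - J) < e'"
      by auto
    have im: "\<bar>Im p\<bar> < R" if "p \<in> pts" for p
      using N[OF that] R(4) abs_Im_le_cmod[of p] by linarith
    have seg: "\<exists>z. (f has_contour_integral z) (linepath x y) \<and> norm z \<le> e' * (\<sigma> - \<tau>)"
      if xy: "Im x = Im y" "\<bar>Im x\<bar> = R" "\<tau> \<le> Re x" "\<tau> \<le> Re y" "Re x \<le> \<sigma>" "Re y \<le> \<sigma>" for x y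
    proof -
      have cs: "\<tau> \<le> Re z \<and> Re z \<le> \<sigma> \<and> \<bar>Im z\<bar> = R" if "z \<in> closed_segment x y" for z
        using that xy by (auto simp: closed_segment_same_Im closed_segment_eq_real_ivl split: if_splits)
      have csS: "z \<in> S - pts" if "z \<in> closed_segment x y" for z
        using cs[OF that] im S(3)[of z] by force
      have cont: "continuous_on (closed_segment x y) f"
        by (rule continuous_on_subset[OF holomorphic_on_imp_continuous_on[OF holo]])
           (use csS in auto)
      show ?thesis
      proof -
        have "norm (f z) \<le> e'" if "z \<in> closed_segment x y" for z
          using cs[OF that] R by (intro Y) auto
        moreover have "\<bar>Re y - Re x\<bar> \<le> \<sigma> - \<tau>" using xy by linarith
        ultimately show ?thesis
          using horizontal_segment_integral[OF cont _ xy(1)] by metis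
      qed
    qed
    let ?a = "Complex \<tau> (-R)" and ?b = "Complex \<sigma> R"
    obtain s1 where s1: "(f has_contour_integral s1) (linepath ?a (Complex \<sigma> (-R)))" "norm s1 \<le> e' * (\<sigma> - \<tau>)"
      using seg[of ?a "Complex \<sigma> (-R)"] R \<tau>\<sigma> by auto
    obtain s2 where s2: "(f has_contour_integral s2) (linepath ?b (Complex \<tau> R))" "norm s2 \<le> e' * (\<sigma> - \<tau>)"
      using seg[of ?b "Complex \<tau> R"] R \<tau>\<sigma> by auto
    have r: "(f has_contour_integral (\<i> * z1)) (linepath (Complex \<sigma> (-R)) ?b)"
      using z1(1) R by (subst has_contour_integral_linepath_same_Re_iff) auto
    have "(f has_contour_integral (\<i> * z2)) (linepath ?a (Complex \<tau> R))"
      using z2(1) R by (subst has_contour_integral_linepath_same_Re_iff) auto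
    then have l: "(f has_contour_integral (- (\<i> * z2))) (linepath (Complex \<tau> R) ?a)"
      using has_contour_integral_reversepath[of "linepath ?a (Complex \<tau> R)"] by simp
    have "(f has_contour_integral (s1 + (\<i> * z1 + (s2 + - (\<i> * z2))))) (rectpath ?a ?b)"
      unfolding rectpath_def Let_def using s1 s2 r l
      by (intro has_contour_integral_join valid_path_join) auto
    then have eq1: "contour_integral (rectpath ?a ?b) f = s1 + (\<i> * z1 + (s2 + - (\<i> * z2)))"
      by (rule contour_integral_unique)
    have sub: "path_image (rectpath ?a ?b) \<subseteq> S - pts"
    proof
      fix z assume z: "z \<in> path_image (rectpath ?a ?b)"
      then have "z \<in> cbox ?a ?b - box ?a ?b"
        using R \<tau>\<sigma> by (subst (asm) path_image_rectpath_cbox_minus_box) auto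
      then show "z \<in> S - pts"
        using S(3)[of z] pts(2)[of z] im[of z] by (auto simp: in_cbox_complex_iff in_box_complex_iff)
    qed
    have "contour_integral (rectpath ?a ?b) f =
        2 * pi * \<i> * (\<Sum>p\<in>pts. winding_number (rectpath ?a ?b) p * residue f p)"
    proof (rule Residue_theorem[OF S(1,2) pts(1) holo _ _ sub])
      show "\<forall>z. z \<notin> S \<longrightarrow> winding_number (rectpath ?a ?b) z = 0"
      proof (intro allI impI winding_number_rectpath_outside)
        fix z assume "z \<notin> S"
        then show "z \<notin> cbox ?a ?b" using S(3)[of z] by (auto simp: in_cbox_complex_iff)
      qed (use R \<tau>\<sigma> in auto)
    qed auto
    also have "(\<Sum>p\<in>pts. winding_number (rectpath ?a ?b) p * residue f p) = (\<Sum>p\<in>pts. residue f p)"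
    proof (rule sum.cong[OF refl])
      fix p assume p: "p \<in> pts"
      have "winding_number (rectpath ?a ?b) p = 1"
        using pts(2)[OF p] im[OF p] by (intro winding_number_rectpath) (auto simp: in_box_complex_iff)
      then show "winding_number (rectpath ?a ?b) p * residue f p = residue f p" by simp
    qed
    finally have "contour_integral (rectpath ?a ?b) f = \<i> * T" by (simp add: T_def)
    with eq1 have eq2: "s1 + (\<i> * z1 + (s2 + - (\<i> * z2))) = \<i> * T" by simp
    have "\<i> * (I - J - T) = - (\<i> * (z1 - I)) + \<i> * (z2 - J) - s1 - s2 + (s1 + (\<i> * z1 + (s2 + - (\<i> * z2))) - \<i> * T)"
      by (simp add: algebra_simps)
    then have "\<i> * (I - J - T) = - (\<i> * (z1 - I)) + \<i> * (z2 - J) - s1 - s2"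
      by (simp only: eq2 diff_self add_0_right)
    then have "norm (I - J - T) = norm (- (\<i> * (z1 - I)) + \<i> * (z2 - J) - s1 - s2)"
      by (metis mult_1 norm_ii norm_mult)
    also have "\<dots> \<le> norm (z1 - I) + norm (z2 - J) + norm s1 + norm s2"
    proof -
      have "norm (\<i> * (z1 - I)) = norm (z1 - I)" "norm (\<i> * (z2 - J)) = norm (z2 - J)"
        by (simp_all add: norm_mult)
      then show ?thesis
      using norm_triangle_ineq4[of "- (\<i> * (z1 - I)) + \<i> * (z2 - J) - s1" s2]
        norm_triangle_ineq4[of "- (\<i> * (z1 - I)) + \<i> * (z2 - J)" s1]
        norm_triangle_ineq[of "- (\<i> * (z1 - I))" "\<i> * (z2 - J)"] norm_minus_cancel[of "\<i> * (z1 - I)"]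
      by linarith
    qed
    also have "\<dots> \<le> e"
      using z1(2) z2(2) s1(2) s2(2) e'2 by linarith
    finally show ?thesis .
  qed
  then have "norm (I - J - T) \<le> 0"
    using field_le_epsilon[of "norm (I - J - T)" 0] by simp
  then show ?thesis by (simp add: T_def)
qed

section \<open>Mellin inversion of the Gamma function\<close>

lemma strip_bounded_Im_sq_Gamma_mult:
  "strip_bounded f \<Longrightarrow> strip_bounded (\<lambda>s. of_real ((Im s)\<^sup>2) * (Gamma s * f s))"
  using strip_bounded_mult[OF strip_bounded_Im_sq_Gamma, of f] by (simp add: mult.assoc)

lemma norm_powr_vertical:
  "x > 0 \<Longrightarrow> norm (of_real x powr (- Complex \<sigma> y)) = x powr (- \<sigma>)"
  by (simp add: norm_powr_real_powr)

text \<open>The factors with i >= 1 exceed i, and the factor for i = 0 is the 1 / 2 on the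
  left.\<close>

lemma prod_half_ge_fact: "fact n / 2 \<le> (\<Prod>i\<in>{0..n}. real i + 1 / 2)"
proof (induction n)
  case (Suc n)
  have "fact (Suc n) / 2 = (real n + 1) * (fact n / 2)" by simp
  also have "\<dots> \<le> (real (Suc n) + 1 / 2) * (\<Prod>i\<in>{0..n}. real i + 1 / 2)"
    using Suc by (intro mult_mono) auto
  also have "\<dots> = (\<Prod>i\<in>{0..Suc n}. real i + 1 / 2)" by simp
  finally show ?case .
qed simp

lemma minus_half_notin_nonpos_Ints: "- real N - 1 / 2 \<notin> \<int>\<^sub>\<le>\<^sub>0"
proof
  assume "- real N - 1 / 2 \<in> \<int>\<^sub>\<le>\<^sub>0"
  then obtain k :: nat where "- real N - 1 / 2 = - of_nat k" by (elim nonpos_Ints_cases')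
  then have "2 * real N + 1 = 2 * real k" by simp
  then have "2 * N + 1 = 2 * k" by linarith
  then show False by presburger
qed

lemma Complex_notin_nonpos_Ints: "\<tau> \<notin> \<int>\<^sub>\<le>\<^sub>0 \<Longrightarrow> Complex \<tau> y \<notin> \<int>\<^sub>\<le>\<^sub>0"
  by (auto elim!: nonpos_Ints_cases simp: complex_eq_iff intro: nonpos_Ints_of_int)

text \<open>N + 1 steps of the recurrence lead from real part - N - 1 / 2 to 1 / 2. The divisors s +
  i have modulus at least |Re (s + i)| = N - i + 1 / 2, and the product of these is at least N! /
  2.\<close>

lemma norm_Gamma_shifted_le:
  "norm (Gamma (Complex (- real N - 1 / 2) y)) \<le> 2 / fact N * norm (Gamma (Complex (1 / 2) y))"
proof -
  define s where "s = Complex (- real N - 1 / 2) y"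
  have s: "s \<notin> \<int>\<^sub>\<le>\<^sub>0"
    unfolding s_def by (intro Complex_notin_nonpos_Ints minus_half_notin_nonpos_Ints)
  have "s + of_nat (Suc N) = Complex (1 / 2) y" by (simp add: s_def complex_eq_iff)
  then have eq: "pochhammer s (Suc N) * Gamma s = Gamma (Complex (1 / 2) y)"
    using s by (simp add: pochhammer_Gamma Gamma_eq_zero_iff)
  have "fact N / 2 \<le> (\<Prod>i\<in>{0..N}. real i + 1 / 2)" by (rule prod_half_ge_fact)
  also have "\<dots> = (\<Prod>i\<in>{0..N}. real (N - i) + 1 / 2)"
    by (rule prod.reindex_bij_witness[of _ "\<lambda>i. N - i" "\<lambda>i. N - i"]) auto
  also have "\<dots> \<le> (\<Prod>i\<in>{0..N}. norm (s + of_nat i))"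
  proof (intro prod_mono conjI)
    fix i assume "i \<in> {0..N}"
    then show "real (N - i) + 1 / 2 \<le> norm (s + of_nat i)"
      using abs_Re_le_cmod[of "s + of_nat i"] by (auto simp: s_def of_nat_diff)
  qed auto
  also have "\<dots> = norm (pochhammer s (Suc N))"
    by (simp add: pochhammer_prod prod_norm atLeastLessThanSuc_atLeastAtMost)
  finally have "fact N / 2 * norm (Gamma s) \<le> norm (pochhammer s (Suc N)) * norm (Gamma s)"
    by (rule mult_right_mono) simp
  also have "\<dots> = norm (Gamma (Complex (1 / 2) y))" by (simp flip: norm_mult eq)
  finally show ?thesis by (simp add: s_def field_simps)
qed

text \<open>Gamma has residue (-1)^n / n! at -n, and x^-s takes the value x^n there.\<close>

lemma residue_Gamma_powr:
  assumes "x > 0"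
  shows "residue (\<lambda>s. Gamma s * of_real x powr (- s)) (- of_nat n) = of_real ((- x) ^ n / fact n)"
proof (rule residue_simple'[where s = "- (\<int>\<^sub>\<le>\<^sub>0 - {- of_nat n})"])
  show "open (- (\<int>\<^sub>\<le>\<^sub>0 - {- of_nat n}) :: complex set)"
    by (intro open_Compl closed_subset_Ints) (auto elim!: nonpos_Ints_cases)
  show "(\<lambda>s. Gamma s * of_real x powr (- s)) holomorphic_on - (\<int>\<^sub>\<le>\<^sub>0 - {- of_nat n}) - {- of_nat n}"
    by (auto intro!: holomorphic_intros)
  have "((\<lambda>w. complex_of_real x powr (- w)) \<longlongrightarrow> of_real x powr (- (- of_nat n))) (at (- of_nat n))"
    using assms by (intro tendsto_intros) auto
  with Gamma_residues[of n]
  have "((\<lambda>w. (Gamma w * (w + of_nat n)) * complex_of_real x powr (- w)) \<longlongrightarrow>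
      ((- 1) ^ n / fact n) * of_real x powr (- (- of_nat n))) (at (- of_nat n))"
    by (rule tendsto_mult)
  also have "((- 1) ^ n / fact n) * of_real x powr (- (- of_nat n)) = complex_of_real ((- x) ^ n / fact n)"
    using assms by (simp add: powr_nat' power_minus[of x] power_minus[of "of_real x :: complex"])
  finally show "((\<lambda>w. Gamma w * of_real x powr (- w) * (w - - of_nat n)) \<longlongrightarrow>
      complex_of_real ((- x) ^ n / fact n)) (at (- of_nat n))"
    by (simp add: mult_ac)
qed auto

text \<open>
  Shifting the line to \<open>Re s = - N - 1 / 2\<close> collects the residues \<open>(- x)\<^sup>n / n!\<close> for \<open>n \<le> N\<close>; the
  remaining integral is \<open>O(x\<^sup>N / N!)\<close>.
\<close>
lemma Gamma_Mellin_inversion: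
  assumes \<sigma>: "\<sigma> > 0" and x: "x > 0"
  shows "integrable lborel (\<lambda>y. Gamma (Complex \<sigma> y) * of_real x powr (- Complex \<sigma> y))"
    and "(\<integral>y. Gamma (Complex \<sigma> y) * of_real x powr (- Complex \<sigma> y) \<partial>lborel) = of_real (2 * pi * exp (- x))"
proof -
  define F where "F = (\<lambda>s. Gamma s * complex_of_real x powr (- s))"
  have sb: "strip_bounded (\<lambda>s. of_real ((Im s)\<^sup>2) * F s)"
    unfolding F_def by (intro strip_bounded_Im_sq_Gamma_mult strip_bounded_powr x)
  have holo: "F holomorphic_on S" if "S \<inter> \<int>\<^sub>\<le>\<^sub>0 = {}" for S
    unfolding F_def using that by (auto intro!: holomorphic_intros)
  have int: "integrable lborel (\<lambda>y. F (Complex \<tau> y))" if \<tau>: "\<tau> \<notin> \<int>\<^sub>\<le>\<^sub>0" for \<tau>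
  proof (rule integrable_vertical_line[OF sb], rule continuous_on_vertical_line)
    show "F holomorphic_on - \<int>\<^sub>\<le>\<^sub>0" by (rule holo) auto
    show "Complex \<tau> y \<in> - \<int>\<^sub>\<le>\<^sub>0" for y
      using \<tau> by (simp add: Complex_notin_nonpos_Ints)
  qed
  have \<sigma>': "\<sigma> \<notin> \<int>\<^sub>\<le>\<^sub>0" using \<sigma> by (auto elim!: nonpos_Ints_cases)
  show "integrable lborel (\<lambda>y. Gamma (Complex \<sigma> y) * of_real x powr (- Complex \<sigma> y))"
    using int[OF \<sigma>'] by (simp add: F_def)
  define L where "L = (\<lambda>\<tau>. \<integral>y. F (Complex \<tau> y) \<partial>lborel)"
  define \<tau> where "\<tau> = (\<lambda>N::nat. - real N - 1 / 2)"
  have \<tau>: "\<tau> N \<notin> \<int>\<^sub>\<le>\<^sub>0" for N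
    unfolding \<tau>_def by (rule minus_half_notin_nonpos_Ints)
  have eq: "L \<sigma> - L (\<tau> N) = of_real (2 * pi * (\<Sum>n\<le>N. (- x) ^ n / fact n))" for N
  proof -
    let ?pts = "(\<lambda>n. - of_nat n :: complex) ` {..N}"
    \<comment> \<open>The poles in this half-plane are exactly 0, ..., -N, and the shifted line lies
      half a unit inside it.\<close>
    let ?S = "{s. - real N - 1 < Re s}"
    have "L \<sigma> - L (\<tau> N) = 2 * pi * (\<Sum>p\<in>?pts. residue F p)"
    proof (rule vertical_line_integral_diff)
      show "open ?S" by (rule open_halfspace_Re_gt)
      show "connected ?S" by (intro convex_connected convex_halfspace_Re_gt)
      show "F holomorphic_on ?S - ?pts"
      proof (rule holo, safe)
        fix s assume s: "s \<in> \<int>\<^sub>\<le>\<^sub>0" "- real N - 1 < Re s" "s \<notin> ?pts"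
        then obtain k :: nat where "s = - of_nat k" by (elim nonpos_Ints_cases')
        with s show "s \<in> {}" by auto
      qed
      show "\<exists>Y. \<forall>s. \<tau> N \<le> Re s \<longrightarrow> Re s \<le> \<sigma> \<longrightarrow> Y \<le> \<bar>Im s\<bar> \<longrightarrow> norm (F s) \<le> e" if "e > 0" for e
        by (rule strip_decay[OF sb that])
      show "((\<lambda>y. F (Complex \<sigma> y)) has_integral L \<sigma>) UNIV" "((\<lambda>y. F (Complex (\<tau> N) y)) has_integral L (\<tau> N)) UNIV"
        unfolding L_def using \<tau> \<sigma>' by (auto intro!: has_integral_integral_lborel int)
    qed (use \<sigma> in \<open>auto simp: \<tau>_def\<close>)
    also have "(\<Sum>p\<in>?pts. residue F p) = (\<Sum>n\<le>N. residue F (- of_nat n))"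
      by (subst sum.reindex) (auto simp: inj_on_def)
    also have "\<dots> = (\<Sum>n\<le>N. of_real ((- x) ^ n / fact n))"
      unfolding F_def by (simp only: residue_Gamma_powr[OF x])
    finally show ?thesis by simp
  qed
  \<comment> \<open>C does not depend on N: \<open>norm_Gamma_shifted_le\<close> compares all
    shifted lines with the single line Re s = 1 / 2.\<close>
  define C where "C = (\<integral>y. norm (Gamma (Complex (1 / 2) y)) \<partial>lborel)"
  have half: "integrable lborel (\<lambda>y. Gamma (Complex (1 / 2) y))"
  proof (rule integrable_vertical_line[OF strip_bounded_Im_sq_Gamma], rule continuous_on_vertical_line)
    show "Gamma holomorphic_on - (\<int>\<^sub>\<le>\<^sub>0 :: complex set)" by (auto intro!: holomorphic_intros)
    show "Complex (1 / 2) y \<in> - \<int>\<^sub>\<le>\<^sub>0" for y by (auto elim!: nonpos_Ints_cases simp: complex_eq_iff)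
  qed
  have bound: "norm (L (\<tau> N)) \<le> 2 * C * x powr (1 / 2) * (inverse (fact N) * x ^ N)" for N
  proof -
    have "norm (L (\<tau> N)) \<le> (\<integral>y. norm (F (Complex (\<tau> N) y)) \<partial>lborel)"
      unfolding L_def by (rule integral_norm_bound)
    also have "\<dots> \<le> (\<integral>y. 2 / fact N * norm (Gamma (Complex (1 / 2) y)) * x powr (- \<tau> N) \<partial>lborel)"
    proof (rule integral_mono)
      show "integrable lborel (\<lambda>y. norm (F (Complex (\<tau> N) y)))" using int[OF \<tau>] by simp
      show "integrable lborel (\<lambda>y. 2 / fact N * norm (Gamma (Complex (1 / 2) y)) * x powr (- \<tau> N))"
        using half by simp
      show "norm (F (Complex (\<tau> N) y)) \<le> 2 / fact N * norm (Gamma (Complex (1 / 2) y)) * x powr (- \<tau> N)" for y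
        unfolding F_def norm_mult norm_powr_vertical[OF x]
        using norm_Gamma_shifted_le[of N y] by (intro mult_right_mono) (auto simp: \<tau>_def)
    qed
    also have "\<dots> = 2 * C / fact N * x powr (- \<tau> N)" by (simp add: C_def)
    also have "x powr (- \<tau> N) = x powr (1 / 2) * x ^ N"
      using x by (simp add: \<tau>_def powr_add powr_realpow)
    finally show ?thesis by (simp add: field_simps)
  qed
  have "(\<lambda>N. inverse (fact N) * x ^ N) \<longlonglongrightarrow> 0"
    using summable_exp[of x] by (rule summable_LIMSEQ_zero)
  then have "(\<lambda>N. 2 * C * x powr (1 / 2) * (inverse (fact N) * x ^ N)) \<longlonglongrightarrow> 0"
    by (rule tendsto_mult_right_zero)
  then have L0: "(\<lambda>N. L (\<tau> N)) \<longlonglongrightarrow> 0"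
    by (rule Lim_null_comparison[rotated]) (use bound in auto)
  have "(\<lambda>n. (- x) ^ n / fact n) sums exp (- x)"
    using exp_converges[of "- x"] by (simp add: divide_inverse_commute)
  then have "(\<lambda>N. \<Sum>n\<le>N. (- x) ^ n / fact n) \<longlonglongrightarrow> exp (- x)"
    by (simp only: sums_def_le)
  then have "(\<lambda>N. complex_of_real (2 * pi * (\<Sum>n\<le>N. (- x) ^ n / fact n))) \<longlonglongrightarrow> of_real (2 * pi * exp (- x))"
    by (intro tendsto_intros)
  moreover have "(\<lambda>N. L \<sigma> - L (\<tau> N)) \<longlonglongrightarrow> L \<sigma> - 0"
    by (intro tendsto_diff tendsto_const L0)
  ultimately have "L \<sigma> = of_real (2 * pi * exp (- x))"
    unfolding eq using LIMSEQ_unique[of _ "L \<sigma> - 0"] by simp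
  then show "(\<integral>y. Gamma (Complex \<sigma> y) * of_real x powr (- Complex \<sigma> y) \<partial>lborel) = of_real (2 * pi * exp (- x))"
    by (simp add: L_def F_def)
qed

section \<open>Positive superpositions of powers\<close>

text \<open>
  Multiplying \<open>x\<^sup>-\<^sup>s\<close> by the kernel \<open>exp (- \<theta> u * s)\<close> replaces \<open>x\<close> by \<open>x * exp (\<theta> u)\<close>, which is why
  superpositions act on Mellin inversion integrals.
\<close>
definition positive_superposition :: "(complex \<Rightarrow> complex) \<Rightarrow> real \<Rightarrow> bool" where
  "positive_superposition \<phi> b \<longleftrightarrow>
     (\<exists>h \<theta>. h \<in> borel_measurable borel \<and> \<theta> \<in> borel_measurable borel \<and> (\<forall>u::real. 0 \<le> h u) \<and>
        \<not> (AE u in lborel. h u = 0) \<and>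
        (\<forall>s. Re s < b \<longrightarrow>
           has_bochner_integral lborel (\<lambda>u. of_real (h u) * exp (- (of_real (\<theta> u) * s))) (\<phi> s)))"

text \<open>Up to the factor 2 \<pi> the integral is the inverse Mellin transform of \<Psi> at x.
  Positivity is asked at every x > 0, since multiplication by a superposition evaluates it at all
  the points x * exp (\<theta> u).\<close>

definition positive_Mellin_line :: "(complex \<Rightarrow> complex) \<Rightarrow> real \<Rightarrow> bool" where
  "positive_Mellin_line \<Psi> \<sigma> \<longleftrightarrow> integrable lborel (\<lambda>y. \<Psi> (Complex \<sigma> y)) \<and>
     (\<forall>x>0. \<exists>r>0. (\<integral>y. \<Psi> (Complex \<sigma> y) * of_real x powr (- Complex \<sigma> y) \<partial>lborel) = of_real r)"

lemma Complex_measurable [measurable]: "(\<lambda>y. Complex \<sigma> y) \<in> borel_measurable borel"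
  by (simp add: Complex_eq)

lemma integrable_vertical_powr:
  assumes "integrable lborel (\<lambda>y. \<Psi> (Complex \<sigma> y))" "x > 0"
  shows "integrable lborel (\<lambda>y. \<Psi> (Complex \<sigma> y) * of_real x powr (- Complex \<sigma> y))"
proof (rule Bochner_Integration.integrable_bound)
  show "integrable lborel (\<lambda>y. x powr (- \<sigma>) * norm (\<Psi> (Complex \<sigma> y)))"
    using assms by simp
  have [measurable]: "(\<lambda>y. \<Psi> (Complex \<sigma> y)) \<in> borel_measurable borel"
    using borel_measurable_integrable[OF assms(1)] by simp
  have "(\<lambda>y. \<Psi> (Complex \<sigma> y) * exp (- Complex \<sigma> y * of_real (ln x))) \<in> borel_measurable lborel"
    by measurable
  then show "(\<lambda>y. \<Psi> (Complex \<sigma> y) * of_real x powr (- Complex \<sigma> y)) \<in> borel_measurable lborel"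
    using assms(2) by (simp add: powr_of_real_pos)
  show "AE y in lborel. norm (\<Psi> (Complex \<sigma> y) * of_real x powr (- Complex \<sigma> y))
      \<le> norm (x powr (- \<sigma>) * norm (\<Psi> (Complex \<sigma> y)))"
    using assms(2) by (intro AE_I2) (simp add: norm_mult norm_powr_vertical del: minus_complex.sel)
qed

text \<open>Let R(z) > 0 be the integral for \<Psi> at z. Exchanging the integrations turns the
  integral for \<phi> \<Psi> at x into the integral of h(u) R(x exp(\<theta>(u))) over u. This
  integrand is nonnegative and vanishes only where h does, so the integral is strictly
  positive.\<close>

lemma positive_Mellin_line_mult:
  assumes \<phi>: "positive_superposition \<phi> b" and \<sigma>: "\<sigma> < b"
    and meas: "(\<lambda>y. \<phi> (Complex \<sigma> y)) \<in> borel_measurable borel"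
    and \<Psi>: "positive_Mellin_line \<Psi> \<sigma>"
  shows "positive_Mellin_line (\<lambda>s. \<phi> s * \<Psi> s) \<sigma>"
proof -
  obtain h \<theta> where [measurable]: "h \<in> borel_measurable borel" "\<theta> \<in> borel_measurable borel"
    and h: "\<And>u::real. 0 \<le> h u" "\<not> (AE u in lborel. h u = 0)"
    and rep: "\<And>s. Re s < b \<Longrightarrow>
      has_bochner_integral lborel (\<lambda>u. of_real (h u) * exp (- (of_real (\<theta> u) * s))) (\<phi> s)"
    using \<phi> unfolding positive_superposition_def by blast
  have int\<Psi>: "integrable lborel (\<lambda>y. \<Psi> (Complex \<sigma> y))"
    using \<Psi> by (simp add: positive_Mellin_line_def)
  have "has_bochner_integral lborel (\<lambda>u. norm (of_real (h u) * exp (- (of_real (\<theta> u) * complex_of_real \<sigma>))))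
      (\<integral>u. norm (of_real (h u) * exp (- (of_real (\<theta> u) * complex_of_real \<sigma>))) \<partial>lborel)"
    using rep[of "of_real \<sigma>"] \<sigma>
    by (intro has_bochner_integral_integrable integrable_norm) (auto simp: has_bochner_integral_iff)
  \<comment> \<open>The modulus of the kernel depends on Re s alone, so the single number
    \<open>H\<close> bounds \<phi> on the whole line and also controls the inner integral in
    Fubini's theorem.\<close>
  then obtain H where H: "has_bochner_integral lborel (\<lambda>u. h u * exp (- (\<theta> u * \<sigma>))) H"
    using h(1) by (auto simp: norm_mult norm_exp_eq_Re)
  have bound: "norm (\<phi> (Complex \<sigma> y)) \<le> H" for y
  proof -
    have "norm (\<integral>u. of_real (h u) * exp (- (of_real (\<theta> u) * Complex \<sigma> y)) \<partial>lborel)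
        \<le> (\<integral>u. norm (of_real (h u) * exp (- (of_real (\<theta> u) * Complex \<sigma> y))) \<partial>lborel)"
      by (rule integral_norm_bound)
    also have "\<dots> = H"
      using H h(1) by (simp add: norm_mult norm_exp_eq_Re has_bochner_integral_iff)
    finally show ?thesis
      using rep[of "Complex \<sigma> y"] \<sigma> by (simp add: has_bochner_integral_iff)
  qed
  have int: "integrable lborel (\<lambda>y. \<phi> (Complex \<sigma> y) * \<Psi> (Complex \<sigma> y))"
  proof (rule Bochner_Integration.integrable_bound)
    show "integrable lborel (\<lambda>y. H * norm (\<Psi> (Complex \<sigma> y)))"
      using int\<Psi> by simp
    show "(\<lambda>y. \<phi> (Complex \<sigma> y) * \<Psi> (Complex \<sigma> y)) \<in> borel_measurable lborel"
      using borel_measurable_times[OF meas] borel_measurable_integrable[OF int\<Psi>] by simp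
    have "norm (\<phi> (Complex \<sigma> y) * \<Psi> (Complex \<sigma> y)) \<le> H * norm (\<Psi> (Complex \<sigma> y))" for y
      unfolding norm_mult by (intro mult_right_mono bound) simp
    then show "AE y in lborel. norm (\<phi> (Complex \<sigma> y) * \<Psi> (Complex \<sigma> y)) \<le> norm (H * norm (\<Psi> (Complex \<sigma> y)))"
      by (intro AE_I2) (metis abs_ge_self order_trans real_norm_def)
  qed
  have "\<exists>r>0. (\<integral>y. \<phi> (Complex \<sigma> y) * \<Psi> (Complex \<sigma> y) * of_real x powr (- Complex \<sigma> y) \<partial>lborel) = of_real r"
    if x: "x > 0" for x
  proof -
    define E where "E = (\<lambda>y. \<Psi> (Complex \<sigma> y) * of_real x powr (- Complex \<sigma> y))"
    define k where "k = (\<lambda>y u. E y * (of_real (h u) * exp (- (of_real (\<theta> u) * Complex \<sigma> y))))"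
    have E: "integrable lborel E"
      unfolding E_def by (rule integrable_vertical_powr[OF int\<Psi> x])
    then have [measurable]: "E \<in> borel_measurable borel" by auto
    have ku: "has_bochner_integral lborel (k y) (E y * \<phi> (Complex \<sigma> y))" for y
      unfolding k_def using \<sigma> by (intro has_bochner_integral_mult_right rep) auto
    have nku: "has_bochner_integral lborel (\<lambda>u. norm (k y u)) (norm (E y) * H)" for y
    proof -
      have "has_bochner_integral lborel (\<lambda>u. norm (E y) * (h u * exp (- (\<theta> u * \<sigma>)))) (norm (E y) * H)"
        by (intro has_bochner_integral_mult_right H)
      then show ?thesis using h(1) by (simp add: k_def norm_mult norm_exp_eq_Re)
    qed
    have pair: "integrable (lborel \<Otimes>\<^sub>M lborel) (\<lambda>(y, u). k y u)"
    proof (rule lborel_pair.Fubini_integrable)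
      show "(\<lambda>(y, u). k y u) \<in> borel_measurable (lborel \<Otimes>\<^sub>M lborel)"
      proof -
        have "(\<lambda>(y, u). k y u) \<in> borel_measurable (borel \<Otimes>\<^sub>M borel)"
          unfolding k_def by measurable
        then show ?thesis by (simp cong: measurable_cong_sets)
      qed
      have "(\<lambda>y. \<integral>u. norm (case (y, u) of (y, u) \<Rightarrow> k y u) \<partial>lborel) = (\<lambda>y. norm (E y) * H)"
        using nku by (simp add: has_bochner_integral_iff)
      then show "integrable lborel (\<lambda>y. \<integral>u. norm (case (y, u) of (y, u) \<Rightarrow> k y u) \<partial>lborel)"
        using E by simp
      show "AE y in lborel. integrable lborel (\<lambda>u. case (y, u) of (y, u) \<Rightarrow> k y u)"
        using ku by (auto simp: has_bochner_integral_iff)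
    qed
    obtain R where R: "\<And>z. z > 0 \<Longrightarrow> R z > 0 \<and>
        (\<integral>y. \<Psi> (Complex \<sigma> y) * of_real z powr (- Complex \<sigma> y) \<partial>lborel) = complex_of_real (R z)"
      using \<Psi> unfolding positive_Mellin_line_def by metis
    have inner: "(\<integral>y. k y u \<partial>lborel) = of_real (h u * R (x * exp (\<theta> u)))" for u
    proof -
      have z: "x * exp (\<theta> u) > 0" using x by simp
      have "k y u = of_real (h u) * (\<Psi> (Complex \<sigma> y) * of_real (x * exp (\<theta> u)) powr (- Complex \<sigma> y))" for y
        unfolding k_def E_def powr_of_real_pos[OF x] powr_of_real_pos[OF z]
        using x by (simp add: ln_mult distrib_left exp_add exp_diff exp_minus mult.commute divide_inverse)
      then have "(\<integral>y. k y u \<partial>lborel) = of_real (h u) *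
          (\<integral>y. \<Psi> (Complex \<sigma> y) * of_real (x * exp (\<theta> u)) powr (- Complex \<sigma> y) \<partial>lborel)"
        by simp
      then show ?thesis using R[OF z] by simp
    qed
    \<comment> \<open>\<open>R\<close> comes from a choice, so its measurability is not at hand;
      Fubini's theorem gives the integrability of the product with h, which equals the inner
      integral.\<close>
    have "integrable lborel (\<lambda>u. \<integral>y. k y u \<partial>lborel)"
      using lborel_pair.integrable_snd[OF pair] .
    then have intr: "integrable lborel (\<lambda>u. h u * R (x * exp (\<theta> u)))"
      unfolding inner by (drule_tac integrable_Re) simp
    have pos: "h u * R (x * exp (\<theta> u)) \<ge> 0" for u
      using h(1)[of u] R[of "x * exp (\<theta> u)"] x by (simp add: less_imp_le)
    have "(\<integral>u. h u * R (x * exp (\<theta> u)) \<partial>lborel) \<noteq> 0"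
    proof
      assume "(\<integral>u. h u * R (x * exp (\<theta> u)) \<partial>lborel) = 0"
      then have "AE u in lborel. h u * R (x * exp (\<theta> u)) = 0"
        using integral_nonneg_eq_0_iff_AE[OF intr] pos by simp
      moreover have "R (x * exp (\<theta> u)) \<noteq> 0" for u using R[of "x * exp (\<theta> u)"] x by auto
      ultimately have "AE u in lborel. h u = 0" by simp
      with h(2) show False by blast
    qed
    moreover have "(\<integral>u. h u * R (x * exp (\<theta> u)) \<partial>lborel) \<ge> 0"
      by (intro Bochner_Integration.integral_nonneg pos)
    ultimately have "(\<integral>u. h u * R (x * exp (\<theta> u)) \<partial>lborel) > 0" by simp
    moreover have "(\<integral>y. \<phi> (Complex \<sigma> y) * \<Psi> (Complex \<sigma> y) * of_real x powr (- Complex \<sigma> y) \<partial>lborel)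
        = (\<integral>y. (\<integral>u. k y u \<partial>lborel) \<partial>lborel)"
      using ku by (simp add: has_bochner_integral_iff E_def mult_ac)
    moreover have "(\<integral>y. (\<integral>u. k y u \<partial>lborel) \<partial>lborel) = (\<integral>u. (\<integral>y. k y u \<partial>lborel) \<partial>lborel)"
      using lborel_pair.Fubini_integral[OF pair] by simp
    moreover have "\<dots> = of_real (\<integral>u. h u * R (x * exp (\<theta> u)) \<partial>lborel)"
      unfolding inner by (rule integral_complex_of_real)
    ultimately show ?thesis by metis
  qed
  with int show ?thesis by (simp add: positive_Mellin_line_def)
qed

lemma positive_Mellin_line_prod:
  assumes "finite I" "positive_Mellin_line \<Psi> \<sigma>"
    and "\<And>i. i \<in> I \<Longrightarrow> positive_superposition (\<phi> i) (b i)" "\<And>i. i \<in> I \<Longrightarrow> \<sigma> < b i"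
    and "\<And>i. i \<in> I \<Longrightarrow> (\<lambda>y. \<phi> i (Complex \<sigma> y)) \<in> borel_measurable borel"
  shows "positive_Mellin_line (\<lambda>s. (\<Prod>i\<in>I. \<phi> i s) * \<Psi> s) \<sigma>"
  using assms(1,3-)
proof (induction I rule: finite_induct)
  case (insert i I)
  then have "positive_Mellin_line (\<lambda>s. \<phi> i s * ((\<Prod>i\<in>I. \<phi> i s) * \<Psi> s)) \<sigma>"
    by (intro positive_Mellin_line_mult[of "\<phi> i" "b i" \<sigma> "\<lambda>s. (\<Prod>i\<in>I. \<phi> i s) * \<Psi> s"]) auto
  then show ?case using insert by (simp add: mult.assoc)
qed (use assms in simp)

lemma not_AE_zero_lborel:
  fixes h :: "real \<Rightarrow> real"
  assumes "\<And>u. 0 < u \<Longrightarrow> u < 1 \<Longrightarrow> h u \<noteq> 0"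
  shows "\<not> (AE u in lborel. h u = 0)"
proof
  assume "AE u in lborel. h u = 0"
  then have "AE u in lborel. u \<notin> {0<..<1::real}"
    by (rule eventually_mono) (use assms in auto)
  then have "{0<..<1::real} \<in> null_sets lborel" by (subst AE_iff_null_sets) auto
  then show False by (simp add: null_sets_def)
qed

text \<open>Euler's integral with u^(-A s) = exp (- A ln u * s): the weight is the unnormalised
  Gamma density, and \<alpha> / A is the real part of s at which Re (\<alpha> - A s) reaches
  0.\<close>

lemma positive_superposition_Gamma:
  assumes "A > 0"
  shows "positive_superposition (\<lambda>s. Gamma (of_real \<alpha> - of_real A * s)) (\<alpha> / A)"
  unfolding positive_superposition_def
proof (intro exI conjI allI impI)
  let ?h = "\<lambda>u::real. indicator {0<..} u * exp ((\<alpha> - 1) * ln u - u) :: real"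
  let ?\<theta> = "\<lambda>u::real. A * ln u"
  show "?h \<in> borel_measurable borel" "?\<theta> \<in> borel_measurable borel" by measurable
  show "0 \<le> ?h u" for u by simp
  show "\<not> (AE u in lborel. ?h u = 0)" by (rule not_AE_zero_lborel) auto
  fix s assume "Re s < \<alpha> / A"
  then have "Re (of_real \<alpha> - of_real A * s) > 0" using assms by (simp add: field_simps)
  from has_bochner_integral_Gamma[OF this]
  show "has_bochner_integral lborel (\<lambda>u. of_real (?h u) * exp (- (of_real (?\<theta> u) * s)))
      (Gamma (of_real \<alpha> - of_real A * s))"
  proof (rule has_bochner_integral_cong[THEN iffD1, rotated -1])
    fix u :: real
    show "indicator {0<..} u *\<^sub>R exp ((of_real \<alpha> - of_real A * s - 1) * of_real (ln u) - of_real u) =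
        of_real (?h u) * exp (- (of_real (?\<theta> u) * s))"
      by (cases "u > 0") (auto simp: algebra_simps simp flip: exp_of_real exp_add)
  qed auto
qed

text \<open>Both arguments share the slope A, so they differ by the constant d = \<beta> - \<alpha>
  > 0, and the quotient is the Beta integral B(\<alpha> - A s, d) divided by Gamma(d).\<close>

lemma positive_superposition_Beta:
  assumes "A > 0" "\<alpha> < \<beta>"
  shows "positive_superposition
           (\<lambda>s. Gamma (of_real \<alpha> - of_real A * s) * rGamma (of_real \<beta> - of_real A * s)) (\<alpha> / A)"
  unfolding positive_superposition_def
proof (intro exI conjI allI impI)
  define d where "d = \<beta> - \<alpha>"
  have d: "d > 0" using assms by (simp add: d_def)
  let ?h = "\<lambda>u::real. indicator {0<..<1} u * exp ((\<alpha> - 1) * ln u + (d - 1) * ln (1 - u)) / Gamma d :: real"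
  let ?\<theta> = "\<lambda>u::real. A * ln u"
  show "?h \<in> borel_measurable borel" "?\<theta> \<in> borel_measurable borel" by measurable
  have Gd: "Gamma d > 0" using d by (rule Gamma_real_pos)
  then show "0 \<le> ?h u" for u by simp
  show "\<not> (AE u in lborel. ?h u = 0)" by (rule not_AE_zero_lborel) (use Gd in auto)
  fix s assume "Re s < \<alpha> / A"
  then have "Re (of_real \<alpha> - of_real A * s) > 0" using assms by (simp add: field_simps)
  from has_bochner_integral_mult_left[OF has_bochner_integral_Beta[OF this d], of "1 / of_real (Gamma d)"]
  have "has_bochner_integral lborel
     (\<lambda>u. (indicator {0<..<1} u *\<^sub>R exp ((of_real \<alpha> - of_real A * s - 1) * of_real (ln u) +
         of_real ((d - 1) * ln (1 - u)))) * (1 / of_real (Gamma d)))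
     (of_real (Gamma d) * Gamma (of_real \<alpha> - of_real A * s) *
       rGamma (of_real \<alpha> - of_real A * s + of_real d) * (1 / of_real (Gamma d)))"
    by simp
  then show "has_bochner_integral lborel (\<lambda>u. of_real (?h u) * exp (- (of_real (?\<theta> u) * s)))
      (Gamma (of_real \<alpha> - of_real A * s) * rGamma (of_real \<beta> - of_real A * s))"
  proof (rule has_bochner_integral_cong[THEN iffD1, rotated -1])
    fix u :: real
    show "(indicator {0<..<1} u *\<^sub>R exp ((of_real \<alpha> - of_real A * s - 1) * of_real (ln u) +
         of_real ((d - 1) * ln (1 - u)))) * (1 / of_real (Gamma d)) =
        of_real (?h u) * exp (- (of_real (?\<theta> u) * s))"
      by (cases "0 < u \<and> u < 1") (auto simp: algebra_simps simp flip: exp_of_real exp_add)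
    show "of_real (Gamma d) * Gamma (of_real \<alpha> - of_real A * s) *
       rGamma (of_real \<alpha> - of_real A * s + of_real d) * (1 / of_real (Gamma d)) =
       Gamma (of_real \<alpha> - of_real A * s) * rGamma (of_real \<beta> - of_real A * s)"
      using Gd by (simp add: d_def)
  qed auto
qed

section \<open>Boundedness of Gamma quotients in strips\<close>

lemma norm_Gamma_quotient_le:
  assumes z: "Re z > 0" and d: "d > 0"
  shows "norm (Gamma z * rGamma (z + of_real d)) \<le> Gamma (Re z) * rGamma (Re z + d)"
proof -
  let ?b = "\<lambda>z u. indicator {0<..<1::real} u *\<^sub>R exp ((z - 1) * of_real (ln u) + of_real ((d - 1) * ln (1 - u)) :: complex)"
  have Gd: "Gamma d > 0" using d by (rule Gamma_real_pos)
  have 1: "has_bochner_integral lborel (?b z) (of_real (Gamma d) * Gamma z * rGamma (z + of_real d))"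
    by (rule has_bochner_integral_Beta[OF z d])
  have 2: "has_bochner_integral lborel (?b (of_real (Re z)))
      (of_real (Gamma d) * Gamma (of_real (Re z)) * rGamma (of_real (Re z) + of_real d))"
    using z d by (intro has_bochner_integral_Beta) auto
  have "norm (\<integral>u. ?b z u \<partial>lborel) \<le> (\<integral>u. norm (?b z u) \<partial>lborel)" by (rule integral_norm_bound)
  also have "\<dots> = (\<integral>u. Re (?b (of_real (Re z)) u) \<partial>lborel)"
    by (intro Bochner_Integration.integral_cong) (auto simp: norm_exp_eq_Re Re_exp indicator_def)
  also have "\<dots> = Re (\<integral>u. ?b (of_real (Re z)) u \<partial>lborel)"
    using 2 by (intro integral_Re) (auto simp: has_bochner_integral_iff)
  also have "\<dots> = Re (of_real (Gamma d * Gamma (Re z) * rGamma (Re z + d)))"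
    using 2 by (simp add: has_bochner_integral_iff Gamma_complex_of_real rGamma_complex_of_real flip: of_real_add)
  also have "\<dots> = Gamma d * (Gamma (Re z) * rGamma (Re z + d))" by simp
  also have "(\<integral>u. ?b z u \<partial>lborel) = of_real (Gamma d) * (Gamma z * rGamma (z + of_real d))"
    using 1 by (simp add: has_bochner_integral_iff mult.assoc)
  also have "norm \<dots> = Gamma d * norm (Gamma z * rGamma (z + of_real d))"
    unfolding norm_mult[of "of_real (Gamma d)"] using Gd by simp
  finally show ?thesis using Gd by simp
qed

text \<open>As for Gamma itself, the strip is shifted to the right, where the Beta integral bounds
  the modulus by the value at the real part. The shift costs a quotient of two Pochhammer symbols;
  each of its n factors (s + d + i) / (s + i) has modulus at most 1 + d, because |s + i| >= 1 when
  |Im s| >= 1.\<close>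

lemma strip_bounded_Gamma_quotient:
  assumes d: "d > 0"
  shows "strip_bounded (\<lambda>s. Gamma s * rGamma (s + of_real d))"
  unfolding strip_bounded_def
proof (intro allI)
  fix a b :: real
  define n where "n = nat \<lceil>1 - a\<rceil>"
  have n: "a + real n \<ge> 1" unfolding n_def by linarith
  have "compact ((\<lambda>x. Gamma x * rGamma (x + d)) ` {a + n..b + n})"
    using n by (intro compact_continuous_image continuous_intros
        continuous_on_compose2[OF continuous_on_rGamma[of UNIV]]) (auto elim!: nonpos_Ints_cases)
  then have "bounded ((\<lambda>x. Gamma x * rGamma (x + d)) ` {a + n..b + n})" by (rule compact_imp_bounded)
  then obtain C where C: "\<And>x. x \<in> {a + n..b + n} \<Longrightarrow> norm (Gamma x * rGamma (x + d)) \<le> C"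
    unfolding bounded_iff by blast
  have "norm (Gamma s * rGamma (s + of_real d)) \<le> C * (1 + d) ^ n" if s: "a \<le> Re s" "Re s \<le> b" "1 \<le> \<bar>Im s\<bar>" for s
  proof -
    have s': "s \<notin> \<int>\<^sub>\<le>\<^sub>0" using s(3) by (intro notin_nonpos_Ints_Im) auto
    let ?p = "pochhammer s n" and ?q = "pochhammer (s + of_real d) n"
    have p1: "?p * Gamma s = Gamma (s + of_nat n)"
      using s' by (simp add: pochhammer_Gamma Gamma_eq_zero_iff)
    have "norm ?p \<ge> 1" using pochhammer_norm_ge[of s 0 n] s by simp
    then have p0: "norm ?p > 0" by linarith
    have "norm ?q = (\<Prod>i\<in>{0..<n}. norm (s + of_real d + of_nat i))"
      by (simp add: pochhammer_prod prod_norm)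
    also have "\<dots> \<le> (\<Prod>i\<in>{0..<n}. (1 + d) * norm (s + of_nat i))"
    proof (intro prod_mono conjI)
      fix i
      have "norm (s + of_nat i) \<ge> 1" using abs_Im_le_cmod[of "s + of_nat i"] s by simp
      then have "d * 1 \<le> d * norm (s + of_nat i)" using d by (intro mult_left_mono) auto
      moreover have "norm (s + of_real d + of_nat i) \<le> norm (s + of_nat i) + d"
        using norm_triangle_ineq[of "s + of_nat i" "of_real d"] d by (simp add: add_ac)
      ultimately show "norm (s + of_real d + of_nat i) \<le> (1 + d) * norm (s + of_nat i)"
        by (simp add: algebra_simps)
    qed auto
    also have "\<dots> = (1 + d) ^ n * norm ?p"
      by (simp add: pochhammer_prod prod_norm prod.distrib)
    finally have q: "norm ?q \<le> (1 + d) ^ n * norm ?p" .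
    have "rGamma (s + of_real d) = ?q * rGamma (s + of_nat n + of_real d)"
      by (subst pochhammer_rGamma[of _ n]) (simp add: add_ac)
    then have "?p * (Gamma s * rGamma (s + of_real d)) =
        ?q * (Gamma (s + of_nat n) * rGamma (s + of_nat n + of_real d))"
      by (simp add: mult_ac flip: p1)
    then have "norm ?p * norm (Gamma s * rGamma (s + of_real d)) =
        norm ?q * norm (Gamma (s + of_nat n) * rGamma (s + of_nat n + of_real d))"
      by (metis norm_mult)
    also have "\<dots> \<le> ((1 + d) ^ n * norm ?p) * C"
    proof (intro mult_mono q)
      have "norm (Gamma (s + of_nat n) * rGamma (s + of_nat n + of_real d))
          \<le> Gamma (Re (s + of_nat n)) * rGamma (Re (s + of_nat n) + d)"
        using s n d by (intro norm_Gamma_quotient_le) auto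
      also have "\<dots> \<le> C" using C[of "Re (s + of_nat n)"] s by (simp add: abs_le_iff)
      finally show "norm (Gamma (s + of_nat n) * rGamma (s + of_nat n + of_real d)) \<le> C" .
    qed (use d in auto)
    finally have "norm ?p * norm (Gamma s * rGamma (s + of_real d)) \<le> norm ?p * (C * (1 + d) ^ n)"
      by (simp add: mult_ac)
    then show ?thesis using p0 by simp
  qed
  then show "\<exists>C Y. \<forall>s. a \<le> Re s \<longrightarrow> Re s \<le> b \<longrightarrow> Y \<le> \<bar>Im s\<bar> \<longrightarrow>
      norm (Gamma s * rGamma (s + of_real d)) \<le> C" by blast
qed

section \<open>Independence of the contour\<close>

text \<open>Closes up a path from \<open>A\<close> to \<open>B\<close> along the vertical line with real part \<open>x\<close>.\<close>
definition detour :: "complex \<Rightarrow> complex \<Rightarrow> real \<Rightarrow> real \<Rightarrow> complex" where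
  "detour A B x = linepath B (Complex x (Im B)) +++
     linepath (Complex x (Im B)) (Complex x (Im A)) +++ linepath (Complex x (Im A)) A"

section \<open>Winding numbers of closed-up paths\<close>

lemma detour_simps [simp]:
  "valid_path (detour A B x)" "path (detour A B x)"
  "pathstart (detour A B x) = B" "pathfinish (detour A B x) = A"
  by (auto simp: detour_def intro!: valid_path_join)

lemma detour_image_subset:
  assumes "convex S" "A \<in> S" "B \<in> S" "Complex x (Im A) \<in> S" "Complex x (Im B) \<in> S"
  shows "path_image (detour A B x) \<subseteq> S"
  unfolding detour_def using assms
  by (intro subset_path_image_join) (auto dest: closed_segment_subset)

lemma detour_image:
  assumes "z \<in> path_image (detour A B x)"
  shows "Im z = Im A \<or> Im z = Im B \<or> Re z = x"
  using assms by (auto simp: detour_def path_image_join closed_segment_same_Im closed_segment_same_Re)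

text \<open>One detour followed by the reverse of the other is a loop in the simply connected set S,
  which misses p; so the loop does not wind around p and both detours contribute equally.\<close>

lemma winding_number_detour_eq:
  assumes "simply_connected S" "p \<notin> S"
    and "path_image (detour A B x) \<subseteq> S" "path_image (detour A B y) \<subseteq> S"
    and "path g" "pathfinish g = B" "p \<notin> path_image g"
  shows "winding_number (g +++ detour A B x) p = winding_number (g +++ detour A B y) p"
proof -
  have "winding_number (detour A B x +++ reversepath (detour A B y)) p = 0"
    using assms by (intro simply_connected_imp_winding_number_zero[of S] path_join_imp subset_path_image_join) auto
  moreover have "p \<notin> path_image (detour A B x)" "p \<notin> path_image (detour A B y)"
    using assms(2-4) by auto
  then have "winding_number (detour A B x +++ reversepath (detour A B y)) p =
      winding_number (detour A B x) p - winding_number (detour A B y) p"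
    by (subst winding_number_join) (auto simp: winding_number_reversepath)
  moreover have "winding_number (g +++ detour A B z) p = winding_number g p + winding_number (detour A B z) p"
    if "path_image (detour A B z) \<subseteq> S" for z
    using that assms by (intro winding_number_join) auto
  ultimately show ?thesis using assms(3,4) by simp
qed

text \<open>The winding number is constant along a connected set that misses the loop, and vanishes
  outside a convex set that contains the loop.\<close>

lemma winding_number_zero_connected:
  assumes "path C" "pathfinish C = pathstart C" "path_image C \<subseteq> S" "convex S"
    and "connected K" "p \<in> K" "q \<in> K" "K \<inter> path_image C = {}" "q \<notin> S"
  shows "winding_number C p = 0"
proof -
  have "winding_number C p = winding_number C q"
    using assms by (intro winding_number_eq[where S = K]) auto
  also have "\<dots> = 0" using assms by (intro winding_number_zero_outside[where s = S]) auto
  finally show ?thesis .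
qed

lemma convex_Re_vimage: "convex S \<Longrightarrow> convex {z. Re z \<in> S}"
  using convex_linear_vimage[of Re S] by (simp add: vimage_def bounded_linear_Re bounded_linear.linear)

text \<open>K reaches q, which lies to the left of the whole path, but may cross the closing line Re
  z = x. Moving that line to Re z = N, to the right of K, lets K connect p to q without meeting the
  closed path, while q lies outside the half-plane containing it.\<close>

lemma winding_number_detour_left:
  assumes g: "path g" "pathstart g = A" "pathfinish g = B" "\<And>z. z \<in> path_image g \<Longrightarrow> - M \<le> Re z"
    and AB: "Im A \<le> - Y" "Y \<le> Im B" "0 < Y"
    and x: "p < x" "- M \<le> x"
    and K: "connected K" "of_real p \<in> K" "of_real q \<in> K" "K \<inter> path_image g = {}" "q < - M"
      "\<And>z. z \<in> K \<Longrightarrow> Re z < N \<and> \<bar>Im z\<bar> < Y"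
    and N: "x \<le> N"
  shows "winding_number (g +++ detour A B x) (of_real p) = 0"
proof -
  have AB': "- M \<le> Re A" "- M \<le> Re B"
    using g(2-4) pathstart_in_path_image[of g] pathfinish_in_path_image[of g] by auto
  have "winding_number (g +++ detour A B x) (of_real p) = winding_number (g +++ detour A B N) (of_real p)"
  proof (rule winding_number_detour_eq)
    \<comment> \<open>Both detours stay in the plane slit along the reals up to p: their horizontal
      parts have nonzero imaginary part and their vertical parts lie to the right of p.\<close>
    show "simply_connected (- complex_of_real ` {..p})"
      by (intro starlike_imp_simply_connected starlike_slotted_complex_plane_left)
    show "path_image (detour A B x) \<subseteq> - complex_of_real ` {..p}"
      using AB x by (auto dest!: detour_image)
    show "path_image (detour A B N) \<subseteq> - complex_of_real ` {..p}"
      using AB x N by (auto dest!: detour_image)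
  qed (use g K in auto)
  also have "\<dots> = 0"
  proof (rule winding_number_zero_connected)
    show "path_image (g +++ detour A B N) \<subseteq> {z. Re z \<in> {-M..}}"
      using g(4) AB' x N
      by (intro subset_path_image_join detour_image_subset convex_Re_vimage) (auto simp: convex_real_interval)
    have "z \<notin> path_image (detour A B N)" if "z \<in> K" for z
      using detour_image[of z A B N] K(6)[OF that] AB by force
    then show "K \<inter> path_image (g +++ detour A B N) = {}"
      using K(4) g by (auto simp: path_image_join)
    show "convex {z. Re z \<in> {-M..}}" by (intro convex_Re_vimage) (auto simp: convex_real_interval)
    show "of_real q \<notin> {z. Re z \<in> {-M..}}" using K by auto
  qed (use g K in auto)
  finally show ?thesis .
qed

text \<open>The mirror image: the slit runs from p to the right, and the closing line is moved to
  the left of K.\<close>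

lemma winding_number_detour_right:
  assumes g: "path g" "pathstart g = A" "pathfinish g = B" "\<And>z. z \<in> path_image g \<Longrightarrow> Re z \<le> M"
    and AB: "Im A \<le> - Y" "Y \<le> Im B" "0 < Y"
    and x: "x < p" "x \<le> M"
    and K: "connected K" "of_real p \<in> K" "of_real q \<in> K" "K \<inter> path_image g = {}" "M < q"
      "\<And>z. z \<in> K \<Longrightarrow> N < Re z \<and> \<bar>Im z\<bar> < Y"
    and N: "N \<le> x"
  shows "winding_number (g +++ detour A B x) (of_real p) = 0"
proof -
  have AB': "Re A \<le> M" "Re B \<le> M"
    using g(2-4) pathstart_in_path_image[of g] pathfinish_in_path_image[of g] by auto
  have "winding_number (g +++ detour A B x) (of_real p) = winding_number (g +++ detour A B N) (of_real p)"
  proof (rule winding_number_detour_eq)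
    show "simply_connected (- complex_of_real ` {p..})"
      by (intro starlike_imp_simply_connected starlike_slotted_complex_plane_right)
    show "path_image (detour A B x) \<subseteq> - complex_of_real ` {p..}"
      using AB x by (auto dest!: detour_image)
    show "path_image (detour A B N) \<subseteq> - complex_of_real ` {p..}"
      using AB x N by (auto dest!: detour_image)
  qed (use g K in auto)
  also have "\<dots> = 0"
  proof (rule winding_number_zero_connected)
    show "path_image (g +++ detour A B N) \<subseteq> {z. Re z \<in> {..M}}"
      using g(4) AB' x N
      by (intro subset_path_image_join detour_image_subset convex_Re_vimage) (auto simp: convex_real_interval)
    have "z \<notin> path_image (detour A B N)" if "z \<in> K" for z
      using detour_image[of z A B N] K(6)[OF that] AB by force
    then show "K \<inter> path_image (g +++ detour A B N) = {}"
      using K(4) g by (auto simp: path_image_join)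
    show "convex {z. Re z \<in> {..M}}" by (intro convex_Re_vimage) (auto simp: convex_real_interval)
    show "of_real q \<notin> {z. Re z \<in> {..M}}" using K by auto
  qed (use g K in auto)
  finally show ?thesis .
qed

text \<open>Truncated integrals run over an interval of the parameter line, but paths live on
  [0, 1]. The chain rule factor b - a cancels the Jacobian; the finitely many parameters where c may
  fail to be differentiable are negligible.\<close>

lemma affine_reparametrization:
  fixes c :: "real \<Rightarrow> complex"
  assumes c: "c piecewise_C1_differentiable_on {a..b}" and ab: "a < b"
    and I: "((\<lambda>y. f (c y) * vector_derivative c (at y)) has_integral I) {a..b}"
  defines "g \<equiv> (\<lambda>u. c ((b - a) * u + a))"
  shows "valid_path g" "(f has_contour_integral I) g"
proof -
  have eq: "(\<lambda>u. (b - a) * u + a) ` {0..1} = {a..b}"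
    using ab by (subst image_affinity_atLeastAtMost) auto
  show "valid_path g"
    using piecewise_C1_differentiable_affine[of c "b - a" a "{0..1}"] c
    unfolding valid_path_def g_def eq by (simp add: o_def)
  obtain S where S: "finite S" "c C1_differentiable_on {a..b} - S"
    using c by (auto simp: piecewise_C1_differentiable_on_def)
  have "((\<lambda>u. f (c ((b - a) *\<^sub>R u + a)) * vector_derivative c (at ((b - a) *\<^sub>R u + a)))
      has_integral (I /\<^sub>R (b - a))) {0..1}"
    using has_integral_affinity'[of _ I a b "b - a" a] I ab by simp
  then have 1: "((\<lambda>u. of_real (b - a) * (f (c ((b - a) *\<^sub>R u + a)) * vector_derivative c (at ((b - a) *\<^sub>R u + a))))
      has_integral (of_real (b - a) * (I /\<^sub>R (b - a)))) {0..1}"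
    by (rule has_integral_mult_right)
  have fin: "finite ((\<lambda>u. (b - a) * u + a) -` S \<inter> {0..1})"
    using S(1) ab by (intro finite_vimage_IntI) (auto simp: inj_on_def)
  have "((\<lambda>u. f (g u) * vector_derivative g (at u)) has_integral (of_real (b - a) * (I /\<^sub>R (b - a)))) {0..1}"
  proof (rule has_integral_spike_finite[OF fin _ 1])
    fix u assume u: "u \<in> {0..1} - ((\<lambda>u. (b - a) * u + a) -` S \<inter> {0..1})"
    then have "(b - a) * u + a \<in> {a..b} - S" using eq by blast
    then obtain D where D: "(c has_vector_derivative D) (at ((b - a) * u + a))"
      using S(2) unfolding C1_differentiable_on_def by blast
    have "((\<lambda>u. (b - a) * u + a) has_vector_derivative (b - a)) (at u)"
      by (auto intro!: derivative_eq_intros simp flip: has_real_derivative_iff_has_vector_derivative)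
    from vector_diff_chain_at[OF this D] have "(g has_vector_derivative (b - a) *\<^sub>R D) (at u)"
      by (simp add: g_def o_def)
    then show "f (g u) * vector_derivative g (at u) = of_real (b - a) *
        (f (c ((b - a) *\<^sub>R u + a)) * vector_derivative c (at ((b - a) *\<^sub>R u + a)))"
      using D by (simp add: vector_derivative_at g_def scaleR_conv_of_real)
  qed
  moreover have "of_real (b - a) * (I /\<^sub>R (b - a)) = I"
    using ab by (simp add: scaleR_conv_of_real flip: of_real_diff)
  ultimately show "(f has_contour_integral I) g"
    by (simp add: has_contour_integral)
qed

section \<open>Topology of vertical contours\<close>

lemma vertical_contour_props:
  assumes "vertical_contour \<gamma> c"
  shows "open (- range c)" "\<exists>M. \<forall>y. \<bar>Re (c y)\<bar> \<le> M"
proof -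
  have pc: "c piecewise_C1_differentiable_on {a..b}" for a b
    using assms by (auto simp: vertical_contour_def)
  have cont: "continuous_on {a..b} c" for a b
    using pc[of a b] by (simp add: piecewise_C1_differentiable_on_def)
  have lim: "((\<lambda>y. Re (c y)) \<longlongrightarrow> \<gamma>) at_bot" "((\<lambda>y. Re (c y)) \<longlongrightarrow> \<gamma>) at_top"
    "filterlim (\<lambda>y. Im (c y)) at_bot at_bot" "filterlim (\<lambda>y. Im (c y)) at_top at_top"
    using assms by (auto simp: vertical_contour_def)
  show "open (- range c)"
  proof (rule Topological_Spaces.openI)
    fix z assume z: "z \<in> - range c"
    \<comment> \<open>Outside a compact parameter interval |Im (c y)| >= r, so in the ball of radius
      r about 0, which contains z, only a compact arc of the contour has to be avoided.\<close>
    define r where "r = norm z + 1"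
    have "eventually (\<lambda>y. r \<le> Im (c y)) at_top" using lim(4) by (auto simp: filterlim_at_top)
    then obtain b where b: "\<And>y. y \<ge> b \<Longrightarrow> r \<le> Im (c y)" by (auto simp: eventually_at_top_linorder)
    have "eventually (\<lambda>y. Im (c y) \<le> - r) at_bot" using lim(3) by (auto simp: filterlim_at_bot)
    then obtain a where a: "\<And>y. y \<le> a \<Longrightarrow> Im (c y) \<le> - r" by (auto simp: eventually_at_bot_linorder)
    define T where "T = - (c ` {a..b}) \<inter> ball 0 r"
    have "open T"
      unfolding T_def by (intro open_Int open_Compl compact_imp_closed compact_continuous_image cont) auto
    moreover have "z \<in> T" using z by (auto simp: T_def r_def)
    moreover have "T \<subseteq> - range c"
    proof (intro subsetI ComplI notI)
      fix w assume w: "w \<in> T" "w \<in> range c"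
      then obtain y where y: "c y \<notin> c ` {a..b}" "norm (c y) < r" by (auto simp: T_def)
      have "y \<in> {a..b}"
        using abs_Im_le_cmod[of "c y"] a[of y] b[of y] y(2) by (cases "y \<le> a"; cases "y \<ge> b") auto
      with y(1) show False by blast
    qed
    ultimately show "\<exists>T. open T \<and> z \<in> T \<and> T \<subseteq> - range c" by blast
  qed
  have "eventually (\<lambda>y. dist (Re (c y)) \<gamma> < 1) at_top" "eventually (\<lambda>y. dist (Re (c y)) \<gamma> < 1) at_bot"
    using tendstoD[OF lim(2), of 1] tendstoD[OF lim(1), of 1] by simp_all
  then obtain a b where ab: "\<And>y. y \<ge> b \<Longrightarrow> dist (Re (c y)) \<gamma> < 1" "\<And>y. y \<le> a \<Longrightarrow> dist (Re (c y)) \<gamma> < 1"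
    unfolding eventually_at_top_linorder eventually_at_bot_linorder by blast
  have "bounded (c ` {a..b})" by (intro compact_imp_bounded compact_continuous_image cont) auto
  then obtain M where M: "\<And>y. y \<in> {a..b} \<Longrightarrow> norm (c y) \<le> M" unfolding bounded_iff by blast
  have "\<bar>Re (c y)\<bar> \<le> max M (\<bar>\<gamma>\<bar> + 1)" for y
    using abs_Re_le_cmod[of "c y"] M[of y] ab[of y]
    by (cases "y \<le> a"; cases "y \<ge> b") (auto simp: dist_real_def)
  then show "\<exists>M. \<forall>y. \<bar>Re (c y)\<bar> \<le> M" by blast
qed

text \<open>In an open set components are path components, so the image of a path serves as
  continuum; its compactness later bounds finitely many continua at once.\<close>

lemma connecting_continuum:
  fixes x y :: "'a :: real_normed_vector"
  assumes "open S" "connected_component S x y"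
  obtains K where "compact K" "connected K" "x \<in> K" "y \<in> K" "K \<subseteq> S"
proof -
  have "path_component S x y"
    using assms by (simp add: open_path_connected_component)
  then obtain g where "path g" "path_image g \<subseteq> S" "pathstart g = x" "pathfinish g = y"
    by (auto simp: path_component_def)
  then show ?thesis
    using that[of "path_image g"] compact_path_image connected_path_image
      pathstart_in_path_image pathfinish_in_path_image by metis
qed

text \<open>A long arc of the contour, closed up by the detour, has integral 0. What separates this
  from J = i I are two truncation errors and the two horizontal sides, all of which become small for
  a long arc.\<close>

lemma vertical_contour_integral_eq:
  fixes c :: "real \<Rightarrow> complex" and G :: "complex \<Rightarrow> complex" and P Q :: "real set"
  assumes c: "vertical_contour \<gamma> c"
    and holo: "G holomorphic_on - complex_of_real ` (P \<union> Q)"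
    and closed: "closed (complex_of_real ` (P \<union> Q))"
    and fin: "\<And>r. finite ((P \<union> Q) \<inter> {-r..r})"
    and P: "\<And>x. x \<in> P \<Longrightarrow> x < \<sigma>" "complex_of_real ` P \<subseteq> contour_left c"
    and Q: "\<And>x. x \<in> Q \<Longrightarrow> \<sigma> < x" "complex_of_real ` Q \<subseteq> contour_right c"
    and decay: "\<And>a b e. e > 0 \<Longrightarrow> \<exists>Y. \<forall>s. a \<le> Re s \<longrightarrow> Re s \<le> b \<longrightarrow> Y \<le> \<bar>Im s\<bar> \<longrightarrow> norm (G s) \<le> e"
    and I: "((\<lambda>y. G (Complex \<sigma> y)) has_integral I) UNIV"
    and J: "((\<lambda>y. G (c y) * vector_derivative c (at y)) has_integral J) UNIV"
  shows "J = \<i> * I"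
proof -
  have pc: "c piecewise_C1_differentiable_on {a..b}" for a b
    using c by (auto simp: vertical_contour_def)
  obtain M' where M': "\<And>y. \<bar>Re (c y)\<bar> \<le> M'" using vertical_contour_props(2)[OF c] by blast
  \<comment> \<open>M bounds the real parts of both the contour and the line, so the closed path
    lies in the strip |Re z| <= M.\<close>
  define M where "M = max M' \<bar>\<sigma>\<bar>"
  have M: "\<bar>Re (c y)\<bar> \<le> M" "\<bar>\<sigma>\<bar> \<le> M" "0 \<le> M" for y
    using M'[of y] by (auto simp: M_def)
  have op: "open (- range c)" by (rule vertical_contour_props(1)[OF c])
  have "\<exists>K. compact K \<and> connected K \<and> of_real p \<in> K \<and> K \<inter> range c = {} \<and>
      (p \<in> P \<longrightarrow> (\<exists>q< -M. of_real q \<in> K)) \<and> (p \<in> Q \<longrightarrow> (\<exists>q>M. of_real q \<in> K))"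
    if p: "p \<in> P \<union> Q" for p
  proof (cases "p \<in> P")
    case True
    then have "eventually (\<lambda>x. connected_component (- range c) (of_real p) (complex_of_real x)) at_bot"
      using P(2) by (auto simp: contour_left_def)
    then have "eventually (\<lambda>x. connected_component (- range c) (of_real p) (complex_of_real x) \<and> x < -M) at_bot"
      by (intro eventually_conj eventually_gt_at_bot)
    then obtain q where "connected_component (- range c) (of_real p) (complex_of_real q)" "q < -M"
      by (auto dest!: eventually_happens)
    note q = this
    from connecting_continuum[OF op q(1)] obtain K where
      "compact K" "connected K" "of_real p \<in> K" "of_real q \<in> K" "K \<subseteq> - range c" .
    moreover have "p \<notin> Q" using P(1)[OF True] Q(1)[of p] by auto
    ultimately show ?thesis using q(2) by (intro exI[of _ K]) auto
  next
    case False
    then have pQ: "p \<in> Q" using p by auto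
    then have "eventually (\<lambda>x. connected_component (- range c) (of_real p) (complex_of_real x)) at_top"
      using Q(2) by (auto simp: contour_right_def)
    then have "eventually (\<lambda>x. connected_component (- range c) (of_real p) (complex_of_real x) \<and> x > M) at_top"
      by (intro eventually_conj eventually_gt_at_top)
    then obtain q where "connected_component (- range c) (of_real p) (complex_of_real q)" "q > M"
      by (auto dest!: eventually_happens)
    note q = this
    from connecting_continuum[OF op q(1)] obtain K where
      "compact K" "connected K" "of_real p \<in> K" "of_real q \<in> K" "K \<subseteq> - range c" .
    then show ?thesis using False q(2) by (intro exI[of _ K]) auto
  qed
  then have "\<forall>p\<in>P \<union> Q. \<exists>K. compact K \<and> connected K \<and> of_real p \<in> K \<and> K \<inter> range c = {} \<and>
      (p \<in> P \<longrightarrow> (\<exists>q< -M. of_real q \<in> K)) \<and> (p \<in> Q \<longrightarrow> (\<exists>q>M. of_real q \<in> K))"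
    by blast
  from bchoice[OF this] obtain K where K': "\<forall>p\<in>P \<union> Q. compact (K p) \<and> connected (K p) \<and> of_real p \<in> K p \<and>
      K p \<inter> range c = {} \<and>
      (p \<in> P \<longrightarrow> (\<exists>q< -M. of_real q \<in> K p)) \<and> (p \<in> Q \<longrightarrow> (\<exists>q>M. of_real q \<in> K p))"
    by blast
  then have K: "\<And>p. p \<in> P \<union> Q \<Longrightarrow> compact (K p)" "\<And>p. p \<in> P \<union> Q \<Longrightarrow> connected (K p)"
      "\<And>p. p \<in> P \<union> Q \<Longrightarrow> of_real p \<in> K p" "\<And>p. p \<in> P \<union> Q \<Longrightarrow> K p \<inter> range c = {}"
      "\<And>p. p \<in> P \<Longrightarrow> \<exists>q< -M. of_real q \<in> K p" "\<And>p. p \<in> Q \<Longrightarrow> \<exists>q>M. of_real q \<in> K p"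
    by simp_all
  have "bounded (\<Union>p\<in>(P \<union> Q) \<inter> {-M..M}. K p)"
    using fin K(1) by (intro bounded_Union) (auto intro: compact_imp_bounded)
  then obtain N' where N': "\<And>p z. p \<in> (P \<union> Q) \<inter> {-M..M} \<Longrightarrow> z \<in> K p \<Longrightarrow> norm z \<le> N'"
    unfolding bounded_iff by blast
  \<comment> \<open>Only poles in [-M, M] need their continua; finitely many of these occur, so one
    square of half-width N contains them all, and N also exceeds |\<sigma>|.\<close>
  define N where "N = max N' M + 1"
  have N: "\<bar>Re z\<bar> < N" "\<bar>Im z\<bar> < N" if "p \<in> (P \<union> Q) \<inter> {-M..M}" "z \<in> K p" for p z
    using N'[OF that] abs_Re_le_cmod[of z] abs_Im_le_cmod[of z] by (auto simp: N_def)
  have N0: "M < N" by (simp add: N_def)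
  have "norm (J - \<i> * I) \<le> e" if e: "e > 0" for e
  proof -
    \<comment> \<open>Two truncation errors of size e' and two horizontal sides of length at most 2
      M add up to e' (2 + 4 M).\<close>
    define e' where "e' = e / (2 + 4 * M)"
    have e': "e' > 0" "2 * e' + 2 * (e' * (2 * M)) = e"
      using e M(3)
      by (auto simp: e'_def divide_simps) (auto simp: algebra_simps)
    obtain B where B: "\<And>a b. ball 0 B \<subseteq> cbox a b \<Longrightarrow>
        \<exists>z. ((\<lambda>y. G (c y) * vector_derivative c (at y)) has_integral z) (cbox a b) \<and> norm (z - J) < e'"
      using J e'(1) unfolding has_integral'[of _ J UNIV] by (simp only: UNIV_I if_True) blast
    obtain D where D: "\<And>a b. ball 0 D \<subseteq> cbox a b \<Longrightarrow>
        \<exists>z. ((\<lambda>y. G (Complex \<sigma> y)) has_integral z) (cbox a b) \<and> norm (z - I) < e'"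
      using I e'(1) unfolding has_integral'[of _ I UNIV] by (simp only: UNIV_I if_True) blast
    obtain Y' where Y': "\<And>s. -M \<le> Re s \<Longrightarrow> Re s \<le> M \<Longrightarrow> Y' \<le> \<bar>Im s\<bar> \<Longrightarrow> norm (G s) \<le> e'"
      using decay[OF e'(1), of "-M" M] by blast
    \<comment> \<open>At this height G has become small, the truncated line integral is close to I,
      and the continua lie strictly between the two horizontal sides.\<close>
    define Y where "Y = max (max Y' D) N"
    have "eventually (\<lambda>y. Y \<le> Im (c y)) at_top" "eventually (\<lambda>y. Im (c y) \<le> - Y) at_bot"
      using c by (auto simp: vertical_contour_def filterlim_at_top filterlim_at_bot)
    then obtain u l where ul: "\<And>y. y \<ge> u \<Longrightarrow> Y \<le> Im (c y)" "\<And>y. y \<le> l \<Longrightarrow> Im (c y) \<le> - Y"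
      unfolding eventually_at_top_linorder eventually_at_bot_linorder by blast
    define R where "R = max (max 1 B) (max u (-l))"
    define a b where "a = c (-R)" and "b = c R"
    have im: "Im a \<le> - Y" "Y \<le> Im b" "0 < Y" "N \<le> Y" "D \<le> Y" "Y' \<le> Y"
      using ul[of "-R"] ul(1)[of R] N0 M(3) by (auto simp: a_def b_def R_def Y_def)
    have "ball 0 B \<subseteq> cbox (-R) R" by (auto simp: R_def)
    from B[OF this] obtain z1 where
      z1: "((\<lambda>y. G (c y) * vector_derivative c (at y)) has_integral z1) {-R..R}" "norm (z1 - J) < e'"
      by auto
    \<comment> \<open>The line is cut at the heights of the two endpoints of the arc, which need not
      be symmetric about 0.\<close>
    have "ball 0 D \<subseteq> cbox (Im a) (Im b)" using im by auto
    from D[OF this] obtain z2 where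
      z2: "((\<lambda>y. G (Complex \<sigma> y)) has_integral z2) {Im a..Im b}" "norm (z2 - I) < e'"
      by auto
    define g where "g = (\<lambda>u. c ((R - (- R)) * u + (- R)))"
    have g: "valid_path g" "(G has_contour_integral z1) g"
      using affine_reparametrization[OF pc[of "-R" R] _ z1(1)] by (auto simp: g_def R_def)
    have g': "path g" "pathstart g = a" "pathfinish g = b" "path_image g \<subseteq> range c"
      using g(1) by (auto simp: g_def pathstart_def pathfinish_def a_def b_def path_image_def valid_path_imp_path)
    let ?S = "- complex_of_real ` (P \<union> Q)"
    let ?C = "g +++ detour a b \<sigma>"
    have opS: "open ?S" using closed by (rule open_Compl)
    have rng: "range c \<inter> complex_of_real ` (P \<union> Q) = {}"
    proof -
      have "of_real p \<notin> range c" if "p \<in> P \<union> Q" for p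
        using K(3)[OF that] K(4)[OF that] by blast
      then show ?thesis by (force simp: disjoint_iff)
    qed
    then have "range c \<subseteq> ?S" by blast
    with g'(4) have gS: "path_image g \<subseteq> ?S" by (rule order_trans)
    have detS: "path_image (detour a b \<sigma>) \<subseteq> ?S"
    proof (intro subsetI ComplI notI)
      fix z assume z: "z \<in> path_image (detour a b \<sigma>)" "z \<in> complex_of_real ` (P \<union> Q)"
      then obtain p where "z = of_real p" "p \<in> P \<union> Q" by blast
      then show False using detour_image[OF z(1)] im P(1)[of p] Q(1)[of p] by auto
    qed
    have im0: "(G has_contour_integral 0) ?C"
    proof (rule Cauchy_theorem_global[OF opS holo])
      show "valid_path ?C" using g g' by (intro valid_path_join) auto
      show "pathfinish ?C = pathstart ?C" using g' by simp
      show "path_image ?C \<subseteq> ?S" using gS detS by (rule subset_path_image_join)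
      fix w assume "w \<notin> ?S"
      then obtain p where p: "w = of_real p" "p \<in> P \<union> Q" by blast
      show "winding_number ?C w = 0"
      proof (cases "p \<in> {-M..M}")
        case False
        show ?thesis
        proof (rule winding_number_zero_outside)
          show "path ?C" "pathfinish ?C = pathstart ?C" using g' by auto
          show "convex {z. Re z \<in> {-M..M}}" by (intro convex_Re_vimage) (auto simp: convex_real_interval)
          show "w \<notin> {z. Re z \<in> {-M..M}}" using False p by auto
          have "Re (c y) \<in> {-M..M}" for y using M(1)[of y] by auto
          then have "range c \<subseteq> {z. Re z \<in> {-M..M}}" by auto
          with M(2) show "path_image ?C \<subseteq> {z. Re z \<in> {-M..M}}"
            using g'(4) by (intro subset_path_image_join detour_image_subset convex_Re_vimage)
              (auto simp: convex_real_interval a_def b_def)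
        qed
      next
        case True
        then have p': "p \<in> (P \<union> Q) \<inter> {-M..M}" using p by auto
        have Kg: "K p \<inter> path_image g = {}" using K(4) p g'(4) by blast
        have Kz: "\<bar>Re z\<bar> < N \<and> \<bar>Im z\<bar> < Y" if "z \<in> K p" for z
          using N[OF p' that] im by auto
        have gM: "-M \<le> Re z \<and> Re z \<le> M" if z: "z \<in> path_image g" for z
        proof -
          obtain y where "z = c y" using z g'(4) by blast
          then show ?thesis using M(1)[of y] by auto
        qed
        show ?thesis
        proof (cases "p \<in> P")
          case True
          then obtain q where q: "q < - M" "of_real q \<in> K p" using K(5) by blast
          show ?thesis unfolding p(1)
          proof (rule winding_number_detour_left[where M = M and N = N and Y = Y and K = "K p" and q = q])
            show "Re z < N \<and> \<bar>Im z\<bar> < Y" if "z \<in> K p" for z using Kz[OF that] by auto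
            show "- M \<le> \<sigma>" "\<sigma> \<le> N" using M(2) N0 by auto
          qed (use g' im P(1) True q Kg gM K(2,3) p in auto)
        next
          case False
          then have pQ: "p \<in> Q" using p by auto
          then obtain q where q: "M < q" "of_real q \<in> K p" using K(6) by blast
          show ?thesis unfolding p(1)
          proof (rule winding_number_detour_right[where M = M and N = "-N" and Y = Y and K = "K p" and q = q])
            show "-N < Re z \<and> \<bar>Im z\<bar> < Y" if "z \<in> K p" for z using Kz[OF that] by auto
            show "\<sigma> \<le> M" "-N \<le> \<sigma>" using M(2) N0 by auto
          qed (use g' im Q(1) pQ q Kg gM K(2,3) p in auto)
        qed
      qed
    qed
    have seg: "\<exists>z. (G has_contour_integral z) (linepath x y) \<and> norm z \<le> e' * (2 * M)"
      if xy: "Im x = Im y" "Y \<le> \<bar>Im x\<bar>" "\<bar>Re x\<bar> \<le> M" "\<bar>Re y\<bar> \<le> M" for x y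
    proof -
      have cs: "\<bar>Re z\<bar> \<le> M \<and> Y \<le> \<bar>Im z\<bar>" if "z \<in> closed_segment x y" for z
        using that xy by (auto simp: closed_segment_same_Im closed_segment_eq_real_ivl split: if_splits)
      have csS: "z \<in> ?S" if "z \<in> closed_segment x y" for z
        using cs[OF that] im by auto
      have cont: "continuous_on (closed_segment x y) G"
        by (rule continuous_on_subset[OF holomorphic_on_imp_continuous_on[OF holo]])
           (use csS in auto)
      show ?thesis
      proof -
        have "norm (G z) \<le> e'" if "z \<in> closed_segment x y" for z
          using cs[OF that] im by (intro Y') auto
        moreover have "\<bar>Re y - Re x\<bar> \<le> 2 * M" using xy by linarith
        ultimately show ?thesis
          using horizontal_segment_integral[OF cont _ xy(1)] by metis
      qed
    qed
    obtain s1 where s1: "(G has_contour_integral s1) (linepath b (Complex \<sigma> (Im b)))" "norm s1 \<le> e' * (2 * M)"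
      using seg[of b "Complex \<sigma> (Im b)"] im M(1)[of R] M(2) by (auto simp: b_def)
    obtain s2 where s2: "(G has_contour_integral s2) (linepath (Complex \<sigma> (Im a)) a)" "norm s2 \<le> e' * (2 * M)"
      using seg[of "Complex \<sigma> (Im a)" a] im M(1)[of "-R"] M(2) by (auto simp: a_def)
    have "(G has_contour_integral (\<i> * z2)) (linepath (Complex \<sigma> (Im a)) (Complex \<sigma> (Im b)))"
      using z2(1) im by (subst has_contour_integral_linepath_same_Re_iff) auto
    then have "(G has_contour_integral (- (\<i> * z2))) (linepath (Complex \<sigma> (Im b)) (Complex \<sigma> (Im a)))"
      using has_contour_integral_reversepath[of "linepath (Complex \<sigma> (Im a)) (Complex \<sigma> (Im b))"] by simp
    then have "(G has_contour_integral (z1 + (s1 + (- (\<i> * z2) + s2)))) ?C"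
      unfolding detour_def using g g' s1 s2
      by (intro has_contour_integral_join valid_path_join) auto
    then have "z1 + (s1 + (- (\<i> * z2) + s2)) = 0"
      using im0 has_contour_integral_unique by blast
    moreover have "J - \<i> * I = - (z1 - J) + \<i> * (z2 - I) - s1 - s2 + (z1 + (s1 + (- (\<i> * z2) + s2)))"
      by (simp add: algebra_simps)
    ultimately have "J - \<i> * I = - (z1 - J) + \<i> * (z2 - I) - s1 - s2"
      by simp
    also have "norm \<dots> \<le> norm (z1 - J) + norm (\<i> * (z2 - I)) + norm s1 + norm s2"
      using norm_triangle_ineq4[of "- (z1 - J) + \<i> * (z2 - I) - s1" s2]
        norm_triangle_ineq4[of "- (z1 - J) + \<i> * (z2 - I)" s1]
        norm_triangle_ineq[of "- (z1 - J)" "\<i> * (z2 - I)"] norm_minus_cancel[of "z1 - J"] by linarith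
    also have "\<dots> \<le> e"
    proof -
      have "norm (\<i> * (z2 - I)) = norm (z2 - I)" by (simp add: norm_mult)
      then show ?thesis using z1(2) z2(2) s1(2) s2(2) e'(2) by linarith
    qed
    finally show ?thesis .
  qed
  then have "norm (J - \<i> * I) \<le> 0"
    using field_le_epsilon[of "norm (J - \<i> * I)" 0] by simp
  then show ?thesis by simp
qed

section \<open>The Fox H-function as a line integral\<close>

lemma vertical_contour_line: "vertical_contour \<sigma> (\<lambda>y. Complex \<sigma> y)"
proof -
  have D: "((\<lambda>y. Complex \<sigma> y) has_vector_derivative \<i>) (at y)" for y
    unfolding Complex_eq by (auto intro!: derivative_eq_intros simp flip: of_real_def)
  then have "(\<lambda>y. Complex \<sigma> y) C1_differentiable_on S" for S
    unfolding C1_differentiable_on_def by (intro exI[of _ "\<lambda>_. \<i>"]) auto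
  then show ?thesis
    by (auto simp: vertical_contour_def inj_def filterlim_ident C1_differentiable_imp_piecewise)
qed

lemma vector_derivative_Complex_line: "vector_derivative (\<lambda>y. Complex \<sigma> y) (at y) = \<i>"
  by (rule vector_derivative_at, unfold Complex_eq) (auto intro!: derivative_eq_intros)

lemma contour_left_line:
  assumes "Re s < \<sigma>"
  shows "s \<in> contour_left (\<lambda>y. Complex \<sigma> y)"
proof -
  have "connected_component (- range (\<lambda>y. Complex \<sigma> y)) s (of_real x)" if "x < \<sigma>" for x
    unfolding connected_component_def using assms that
    by (intro exI[of _ "{z. Re z < \<sigma>}"] conjI convex_connected convex_halfspace_Re_lt) auto
  with eventually_gt_at_bot[of \<sigma>] show ?thesis
    unfolding contour_left_def mem_Collect_eq by (rule eventually_mono)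
qed

lemma contour_right_line:
  assumes "\<sigma> < Re s"
  shows "s \<in> contour_right (\<lambda>y. Complex \<sigma> y)"
proof -
  have "connected_component (- range (\<lambda>y. Complex \<sigma> y)) s (of_real x)" if "\<sigma> < x" for x
    unfolding connected_component_def using assms that
    by (intro exI[of _ "{z. \<sigma> < Re z}"] conjI convex_connected convex_halfspace_Re_gt) auto
  with eventually_gt_at_top[of \<sigma>] show ?thesis
    unfolding contour_right_def mem_Collect_eq by (rule eventually_mono)
qed

text \<open>The definite description needs existence, for which the line is the witness, and
  uniqueness, which \<open>vertical_contour_integral_eq\<close> gives for every admissible contour
  on which the integral converges. On the line ds = i dy, so 2 \<pi> i becomes 2 \<pi>.\<close>

lemma fox_H_eq_line_integral:
  fixes P Q :: "real set"
  defines "G m n as bs z \<equiv> (\<lambda>s. fox_Xi m n as bs s * of_real z powr (- s))"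
  assumes left: "fox_left_poles m bs = of_real ` P" and right: "fox_right_poles n as = of_real ` Q"
    and closed: "closed (complex_of_real ` (P \<union> Q))"
    and fin: "\<And>r. finite ((P \<union> Q) \<inter> {-r..r})"
    and P: "\<And>x. x \<in> P \<Longrightarrow> x < \<sigma>" and Q: "\<And>x. x \<in> Q \<Longrightarrow> \<sigma> < x"
    and holo: "G m n as bs z holomorphic_on - complex_of_real ` (P \<union> Q)"
    and decay: "strip_bounded (\<lambda>s. of_real ((Im s)\<^sup>2) * G m n as bs z s)"
  shows "fox_H m n as bs z = (\<integral>y. G m n as bs z (Complex \<sigma> y) \<partial>lborel) / (2 * pi)"
proof -
  define I where "I = (\<integral>y. G m n as bs z (Complex \<sigma> y) \<partial>lborel)"
  have "integrable lborel (\<lambda>y. G m n as bs z (Complex \<sigma> y))"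
  proof (rule integrable_vertical_line[OF decay], rule continuous_on_vertical_line[OF holo])
    show "Complex \<sigma> y \<in> - complex_of_real ` (P \<union> Q)" for y
    proof (intro ComplI notI)
      assume "Complex \<sigma> y \<in> complex_of_real ` (P \<union> Q)"
      then obtain x where "Complex \<sigma> y = of_real x" "x \<in> P \<union> Q" by blast
      then show False using P[of x] Q[of x] by (auto simp: complex_eq_iff)
    qed
  qed
  then have I: "((\<lambda>y. G m n as bs z (Complex \<sigma> y)) has_integral I) UNIV"
    unfolding I_def by (rule has_integral_integral_lborel)
  show ?thesis
    unfolding fox_H_def I_def[symmetric]
  proof (rule the_equality)
    let ?c = "\<lambda>y. Complex \<sigma> y"
    have "fox_contour m n as bs ?c"
      unfolding fox_contour_def left right using P Q
      by (auto intro: vertical_contour_line contour_left_line contour_right_line)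
    moreover have "((\<lambda>y. fox_Xi m n as bs (?c y) * of_real z powr (- ?c y) * vector_derivative ?c (at y))
        has_integral I * \<i>) UNIV"
      unfolding vector_derivative_Complex_line using has_integral_mult_left[OF I, of \<i>]
      by (simp add: G_def)
    moreover have "I / (2 * pi) = I * \<i> / (2 * of_real pi * \<i>)" by simp
    ultimately show "\<exists>c J. fox_contour m n as bs c \<and>
        ((\<lambda>y. fox_Xi m n as bs (c y) * of_real z powr (- c y) * vector_derivative c (at y))
           has_integral J) UNIV \<and> I / (2 * pi) = J / (2 * of_real pi * \<i>)"
      by blast
  next
    fix I' assume "\<exists>c J. fox_contour m n as bs c \<and>
        ((\<lambda>y. fox_Xi m n as bs (c y) * of_real z powr (- c y) * vector_derivative c (at y))
           has_integral J) UNIV \<and> I' = J / (2 * of_real pi * \<i>)"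
    then obtain c J \<gamma> where c: "vertical_contour \<gamma> c" "of_real ` P \<subseteq> contour_left c" "of_real ` Q \<subseteq> contour_right c"
      and J: "((\<lambda>y. G m n as bs z (c y) * vector_derivative c (at y)) has_integral J) UNIV"
      and I': "I' = J / (2 * of_real pi * \<i>)"
      unfolding fox_contour_def left right G_def by blast
    have "J = \<i> * I"
      by (rule vertical_contour_integral_eq[OF c(1) holo closed fin P c(2) Q c(3) strip_decay[OF decay] I J])
    then show "I' = I / (2 * pi)" using I' by simp
  qed
qed

section \<open>Poles and integrand of the Wright function\<close>

lemma finite_Ints_affine_Icc:
  fixes \<alpha> A r :: real
  assumes "A \<noteq> 0"
  shows "finite ({x. \<alpha> - A * x \<in> \<int>} \<inter> {-r..r})"
proof (rule finite_subset)
  let ?C = "\<bar>\<alpha>\<bar> + \<bar>A\<bar> * \<bar>r\<bar>"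
  show "finite ((\<lambda>n. (\<alpha> - real_of_int n) / A) ` {- \<lceil>?C\<rceil>..\<lceil>?C\<rceil>})" by simp
  show "{x. \<alpha> - A * x \<in> \<int>} \<inter> {-r..r} \<subseteq> (\<lambda>n. (\<alpha> - real_of_int n) / A) ` {- \<lceil>?C\<rceil>..\<lceil>?C\<rceil>}"
  proof safe
    fix x assume x: "\<alpha> - A * x \<in> \<int>" "x \<in> {-r..r}"
    then obtain n where n: "\<alpha> - A * x = of_int n" by (auto elim: Ints_cases)
    have "\<bar>A * x\<bar> \<le> \<bar>A\<bar> * \<bar>r\<bar>" unfolding abs_mult using x(2) by (intro mult_left_mono) auto
    then have "\<bar>real_of_int n\<bar> \<le> ?C" unfolding n[symmetric] by linarith
    then have "n \<in> {- \<lceil>?C\<rceil>..\<lceil>?C\<rceil>}" by (auto simp: abs_le_iff) linarith+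
    moreover have "x = (\<alpha> - real_of_int n) / A" using assms n by (simp add: field_simps)
    ultimately show "x \<in> (\<lambda>n. (\<alpha> - real_of_int n) / A) ` {- \<lceil>?C\<rceil>..\<lceil>?C\<rceil>}" by blast
  qed
qed

text \<open>Solving for s shows that every pole is real, so the pole sets can be handled as sets of
  real numbers.\<close>

lemma nonpos_Ints_affine_complex:
  fixes \<alpha> A :: real
  assumes "A \<noteq> 0"
  shows "{s. complex_of_real \<alpha> - of_real A * s \<in> \<int>\<^sub>\<le>\<^sub>0} = of_real ` {x. \<alpha> - A * x \<in> \<int>\<^sub>\<le>\<^sub>0}"
proof (intro set_eqI iffI)
  fix s assume "s \<in> {s. complex_of_real \<alpha> - of_real A * s \<in> \<int>\<^sub>\<le>\<^sub>0}"
  then obtain n where n: "n \<le> 0" "complex_of_real \<alpha> - of_real A * s = of_int n" by (auto elim!: nonpos_Ints_cases)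
  then have s: "s = of_real ((\<alpha> - of_int n) / A)" using assms by (simp add: field_simps)
  then have "\<alpha> - A * ((\<alpha> - of_int n) / A) = of_int n" using assms by simp
  then have "\<alpha> - A * ((\<alpha> - of_int n) / A) \<in> \<int>\<^sub>\<le>\<^sub>0" using n(1) by (simp add: nonpos_Ints_of_int)
  with s show "s \<in> of_real ` {x. \<alpha> - A * x \<in> \<int>\<^sub>\<le>\<^sub>0}" by blast
next
  fix s assume "s \<in> complex_of_real ` {x. \<alpha> - A * x \<in> \<int>\<^sub>\<le>\<^sub>0}"
  then obtain x where "s = of_real x" "\<alpha> - A * x \<in> \<int>\<^sub>\<le>\<^sub>0" by blast
  then show "s \<in> {s. complex_of_real \<alpha> - of_real A * s \<in> \<int>\<^sub>\<le>\<^sub>0}"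
    using of_real_in_nonpos_Ints_iff[of "\<alpha> - A * x", where 'a = complex] by simp
qed

lemma closed_nonpos_Ints_affine:
  "closed {s. complex_of_real \<alpha> - of_real A * s \<in> \<int>\<^sub>\<le>\<^sub>0}"
proof -
  have "closed ((\<lambda>s. complex_of_real \<alpha> - of_real A * s) -` \<int>\<^sub>\<le>\<^sub>0)"
    by (intro closed_vimage closed_subset_Ints continuous_intros) auto
  then show ?thesis by (simp add: vimage_def)
qed

lemma prod_nth_eq_prod_list:
  "n = length xs \<Longrightarrow> (\<Prod>j<n. f (xs ! j)) = prod_list (map f xs)"
  by (simp add: prod.list_conv_set_nth atLeast0LessThan)

text \<open>The parameters are complemented twice, once in \<open>wright_W\<close> and once in
  \<open>fox_Xi\<close>, so \<alpha> itself reappears. The head (0, 1) with m = 1 supplies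
  Gamma(s).\<close>

lemma wright_Xi:
  fixes \<omega> \<Lambda> v w a :: "nat \<Rightarrow> real" and k p :: nat
  defines "as \<equiv> map (\<lambda>j. (complex_of_real (\<omega> (k - j + 1)), \<Lambda> (k - j + 1))) [1..<k+1] @
              map (\<lambda>j. (of_real (v j), a j)) [1..<p+1]"
    and "bs \<equiv> map (\<lambda>j. (complex_of_real (w j), a j)) [1..<p+1]"
  shows "fox_Xi 1 (length as) (map (\<lambda>(\<alpha>, A). (1 - \<alpha>, A)) as) ((0, 1) # map (\<lambda>(\<beta>, B). (1 - \<beta>, B)) bs) s =
    (\<Prod>j\<in>{1..p}. Gamma (of_real (v j) - of_real (a j) * s) * rGamma (of_real (w j) - of_real (a j) * s)) *
    ((\<Prod>j\<in>{1..k}. Gamma (of_real (\<omega> j) - of_real (\<Lambda> j) * s)) * Gamma s)"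
proof -
  let ?f = "\<lambda>x. Gamma (1 - fst x - of_real (snd x) * s)"
  let ?as = "map (\<lambda>(\<alpha>, A). (1 - \<alpha>, A)) as" and ?bs = "map (\<lambda>(\<beta>, B). (1 - \<beta>, B)) bs"
  have ivl: "set [1..<n+1] = {1..n}" for n by auto
  have pl: "prod_list (map g [1..<n+1]) = (\<Prod>j\<in>{1..n}. g j)" for g :: "nat \<Rightarrow> complex" and n
    using prod.distinct_set_conv_list[of "[1..<n+1]" g] unfolding ivl by simp
  have "(\<Prod>j<length as. ?f (?as ! j)) = prod_list (map ?f ?as)"
    by (rule prod_nth_eq_prod_list) simp
  also have "\<dots> = (\<Prod>j\<in>{1..k}. Gamma (of_real (\<omega> (k - j + 1)) - of_real (\<Lambda> (k - j + 1)) * s)) *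
      (\<Prod>j\<in>{1..p}. Gamma (of_real (v j) - of_real (a j) * s))"
    unfolding as_def map_append prod_list.append map_map o_def pl by simp
  also have "(\<Prod>j\<in>{1..k}. Gamma (of_real (\<omega> (k - j + 1)) - of_real (\<Lambda> (k - j + 1)) * s)) =
      (\<Prod>j\<in>{1..k}. Gamma (of_real (\<omega> j) - of_real (\<Lambda> j) * s))"
    by (rule prod.reindex_bij_witness[of _ "\<lambda>j. k - j + 1" "\<lambda>j. k - j + 1"]) auto
  finally have 1: "(\<Prod>j<length as. ?f (?as ! j)) = (\<Prod>j\<in>{1..k}. Gamma (of_real (\<omega> j) - of_real (\<Lambda> j) * s)) *
      (\<Prod>j\<in>{1..p}. Gamma (of_real (v j) - of_real (a j) * s))" .
  \<comment> \<open>Index 0 holds the pair (0, 1), which belongs to the numerator; the denominator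
    starts at 1, so the remaining indices shift by one.\<close>
  have "(\<Prod>j=1..<length ((0, 1) # ?bs). ?f (((0, 1) # ?bs) ! j)) = (\<Prod>j<length ?bs. ?f (?bs ! j))"
    by (rule prod.reindex_bij_witness[of _ Suc "\<lambda>j. j - 1"]) auto
  also have "\<dots> = prod_list (map ?f ?bs)"
    by (rule prod_nth_eq_prod_list) simp
  also have "\<dots> = (\<Prod>j\<in>{1..p}. Gamma (of_real (w j) - of_real (a j) * s))"
    unfolding bs_def map_map o_def pl by simp
  finally have 2: "(\<Prod>j=1..<length ((0, 1) # ?bs). ?f (((0, 1) # ?bs) ! j)) =
      (\<Prod>j\<in>{1..p}. Gamma (of_real (w j) - of_real (a j) * s))" .
  show ?thesis
    \<comment> \<open>All upper parameters are in the numerator, so the second denominator product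
      is empty. Dividing by \<open>Gamma\<close> agrees with multiplying by \<open>rGamma\<close>
      even at poles, by the conventions for both.\<close>
    unfolding fox_Xi_def 1 2
    by (simp add: prod.distrib rGamma_inverse_Gamma divide_inverse o_def flip: prod_inversef)
qed

lemma continuous_Gamma_affine_line:
  assumes "A > 0" "\<sigma> < \<alpha> / A"
  shows "continuous_on UNIV (\<lambda>y. Gamma (complex_of_real \<alpha> - of_real A * Complex \<sigma> y))"
proof (rule continuous_on_vertical_line[where S = "{s. of_real \<alpha> - of_real A * s \<notin> \<int>\<^sub>\<le>\<^sub>0}"])
  show "(\<lambda>s. Gamma (of_real \<alpha> - of_real A * s)) holomorphic_on {s. of_real \<alpha> - of_real A * s \<notin> \<int>\<^sub>\<le>\<^sub>0}"
    by (auto intro!: holomorphic_intros)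
  have "\<alpha> - A * \<sigma> > 0" using assms by (simp add: field_simps)
  then show "Complex \<sigma> y \<in> {s. of_real \<alpha> - of_real A * s \<notin> \<int>\<^sub>\<le>\<^sub>0}" for y
    by (auto elim!: nonpos_Ints_cases simp: complex_eq_iff)
qed

section \<open>Positivity\<close>

theorem corollary6p2:
  fixes p' k :: nat and a v w \<omega> \<Lambda> :: "nat \<Rightarrow> real" and t :: real
  assumes "\<And>j. j \<in> {1..p'} \<Longrightarrow> a j > 0"
    and "\<And>j. j \<in> {1..p'} \<Longrightarrow> v j > 0"
    and "\<And>j. j \<in> {1..p'} \<Longrightarrow> w j \<ge> v j + 1"
    and "\<And>j l l' :: nat. j \<in> {1..p'} \<Longrightarrow> a j * real l \<noteq> - v j - real l'"
    and "k \<ge> 1"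
    and "\<And>j. j \<in> {1..k} \<Longrightarrow> \<omega> j > 0"
    and "\<And>j. j \<in> {1..k} \<Longrightarrow> \<Lambda> j > 0"
    and "(\<Sum>l=1..k. \<Lambda> l) < 1"
    and "t > 0"
  defines "W \<equiv> wright_W
             (map (\<lambda>j. (of_real (\<omega> (k - j + 1)), \<Lambda> (k - j + 1))) [1..<k+1] @
              map (\<lambda>j. (of_real (v j), a j)) [1..<p'+1])
             (map (\<lambda>j. (of_real (w j), a j)) [1..<p'+1])
             (- t)"
  shows "W \<in> \<real> \<and> Re W > 0"
proof -
  define as where "as = map (\<lambda>j. (complex_of_real (\<omega> (k - j + 1)), \<Lambda> (k - j + 1))) [1..<k+1] @
              map (\<lambda>j. (of_real (v j), a j)) [1..<p'+1]"
  define bs where "bs = map (\<lambda>j. (complex_of_real (w j), a j)) [1..<p'+1]"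
  define as' where "as' = map (\<lambda>(\<alpha>, A). (1 - \<alpha>, A)) as"
  define bs' where "bs' = (0, 1) # map (\<lambda>(\<beta>, B). (1 - \<beta>, B)) bs"
  \<comment> \<open>Every Gamma factor with poles on the right has the form Gamma(\<alpha> - A s)
    with (\<alpha>, A) in \<open>D\<close>.\<close>
  define D where "D = (\<lambda>j. (\<omega> j, \<Lambda> j)) ` {1..k} \<union> (\<lambda>j. (v j, a j)) ` {1..p'}"
  have D: "finite D" "\<And>\<alpha> A. (\<alpha>, A) \<in> D \<Longrightarrow> \<alpha> > 0 \<and> A > 0" "D \<noteq> {}"
    using assms(1,2,5-7) by (auto simp: D_def)
  \<comment> \<open>\<alpha> / A is the leftmost pole of Gamma(\<alpha> - A s). Half the least of
    these lies strictly between 0, the rightmost pole of Gamma(s), and all poles on the right; the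
    minimum exists since k >= 1.\<close>
  define \<sigma> where "\<sigma> = Min ((\<lambda>(\<alpha>, A). \<alpha> / A) ` D) / 2"
  have m: "Min ((\<lambda>(\<alpha>, A). \<alpha> / A) ` D) > 0"
    using D by (subst Min_gr_iff) auto
  then have \<sigma>0: "\<sigma> > 0" by (simp add: \<sigma>_def)
  have \<sigma>: "\<sigma> < \<alpha> / A" if "(\<alpha>, A) \<in> D" for \<alpha> A
  proof -
    have "Min ((\<lambda>(\<alpha>, A). \<alpha> / A) ` D) \<le> \<alpha> / A"
      using D(1) that by (intro Min_le) force+
    with m show ?thesis unfolding \<sigma>_def by linarith
  qed
  define P where "P = {x::real. x \<in> \<int>\<^sub>\<le>\<^sub>0}"
  define Q where "Q = (\<Union>(\<alpha>, A)\<in>D. {x. \<alpha> - A * x \<in> \<int>\<^sub>\<le>\<^sub>0})"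
  \<comment> \<open>With \<alpha> = 0 and A = -1 the affine form covers the poles of Gamma(s) as
    well.\<close>
  have P_eq: "complex_of_real ` P = \<int>\<^sub>\<le>\<^sub>0"
    using nonpos_Ints_affine_complex[of "-1" 0] by (simp add: P_def)
  have Q_eq: "complex_of_real ` Q = (\<Union>(\<alpha>, A)\<in>D. {s. of_real \<alpha> - of_real A * s \<in> \<int>\<^sub>\<le>\<^sub>0})"
  proof -
    have "complex_of_real ` Q = (\<Union>x\<in>D. of_real ` (case x of (\<alpha>, A) \<Rightarrow> {x. \<alpha> - A * x \<in> \<int>\<^sub>\<le>\<^sub>0}))"
      unfolding Q_def by (rule image_UN)
    also have "\<dots> = (\<Union>(\<alpha>, A)\<in>D. {s. of_real \<alpha> - of_real A * s \<in> \<int>\<^sub>\<le>\<^sub>0})"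
    proof (rule SUP_cong[OF refl])
      fix x assume "x \<in> D"
      moreover obtain \<alpha> A where "x = (\<alpha>, A)" by (cases x)
      ultimately show "of_real ` (case x of (\<alpha>, A) \<Rightarrow> {x. \<alpha> - A * x \<in> \<int>\<^sub>\<le>\<^sub>0}) =
          (case x of (\<alpha>, A) \<Rightarrow> {s. complex_of_real \<alpha> - of_real A * s \<in> \<int>\<^sub>\<le>\<^sub>0})"
        using D(2)[of \<alpha> A] nonpos_Ints_affine_complex[of A \<alpha>] by simp
    qed
    finally show ?thesis .
  qed
  have left: "fox_left_poles 1 bs' = of_real ` P"
    unfolding P_eq by (auto simp: fox_left_poles_def bs'_def)
  have D_as: "(\<lambda>(\<alpha>, A). (complex_of_real \<alpha>, A)) ` D = set as"
  proof -
    \<comment> \<open>The reversal j -> k - j + 1 permutes {1..k}, so the order of the first list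
      does not affect the set of poles.\<close>
    have "(\<lambda>j. k - j + 1) ` {1..k} = {1..k}"
    proof (intro equalityI subsetI)
      fix j assume "j \<in> {1..k}"
      then have "j = k - (k - j + 1) + 1" "k - j + 1 \<in> {1..k}" by auto
      then show "j \<in> (\<lambda>j. k - j + 1) ` {1..k}" by blast
    qed auto
    then have "(\<lambda>j. (complex_of_real (\<omega> j), \<Lambda> j)) ` {1..k} =
        (\<lambda>j. (complex_of_real (\<omega> (k - j + 1)), \<Lambda> (k - j + 1))) ` {1..k}"
      by (metis (no_types, lifting) image_cong image_image)
    moreover have "set [1..<n+1] = {1..n}" for n by auto
    ultimately show ?thesis
      unfolding D_def as_def set_append set_map image_Un image_image prod.case by simp
  qed
  have right: "fox_right_poles (length as) as' = of_real ` Q"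
  proof -
    have "fox_right_poles (length as) as' =
        {s. \<exists>j<length as. fst (as ! j) - of_real (snd (as ! j)) * s \<in> \<int>\<^sub>\<le>\<^sub>0}"
      unfolding fox_right_poles_def as'_def by (simp add: case_prod_unfold cong: conj_cong)
    also have "\<dots> = {s. \<exists>x\<in>set as. fst x - of_real (snd x) * s \<in> \<int>\<^sub>\<le>\<^sub>0}"
    proof -
      have "(\<exists>j<length as. R (as ! j)) \<longleftrightarrow> (\<exists>x\<in>set as. R x)" for R
        by (metis in_set_conv_nth)
      from this[of "\<lambda>x. fst x - of_real (snd x) * _ \<in> \<int>\<^sub>\<le>\<^sub>0"] show ?thesis
        by (rule Collect_cong)
    qed
    also have "\<dots> = of_real ` Q"
      unfolding Q_eq D_as[symmetric] by (auto simp: case_prod_unfold)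
    finally show ?thesis .
  qed
  have closed: "closed (complex_of_real ` (P \<union> Q))"
    unfolding image_Un P_eq Q_eq using D(1)
    by (intro closed_Un closed_UN) (auto intro: closed_subset_Ints closed_nonpos_Ints_affine)
  have fin: "finite ((P \<union> Q) \<inter> {-r..r})" for r
  proof -
    \<comment> \<open>The pair (0, -1) again stands for the poles of Gamma(s), so both families are
      treated alike.\<close>
    have "finite (\<Union>(\<alpha>, A)\<in>insert (0, -1) D. {x. \<alpha> - A * x \<in> \<int>} \<inter> {-r..r})"
    proof (intro finite_UN_I)
      fix x assume x: "x \<in> insert (0, -1) D"
      obtain \<alpha> A where xx: "x = (\<alpha>, A)" by (cases x)
      with x D(2)[of \<alpha> A] have "A \<noteq> 0" by auto
      then show "finite (case x of (\<alpha>, A) \<Rightarrow> {x. \<alpha> - A * x \<in> \<int>} \<inter> {-r..r})"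
        unfolding xx by (simp add: finite_Ints_affine_Icc)
    qed (use D(1) in simp)
    then show ?thesis
      by (rule rev_finite_subset) (fastforce simp: P_def Q_def)
  qed
  have Pless: "x < \<sigma>" if "x \<in> P" for x
    using that \<sigma>0 by (auto simp: P_def dest: nonpos_Ints_nonpos)
  have Qgr: "\<sigma> < x" if xQ: "x \<in> Q" for x
  proof -
    obtain \<alpha> A where x: "(\<alpha>, A) \<in> D" "\<alpha> - A * x \<in> \<int>\<^sub>\<le>\<^sub>0" using xQ by (auto simp: Q_def)
    then have "\<alpha> / A \<le> x" using D(2)[OF x(1)] by (auto dest!: nonpos_Ints_nonpos simp: field_simps)
    with \<sigma>[OF x(1)] show ?thesis by linarith
  qed
  define \<phi> where "\<phi> = (\<lambda>j s. Gamma (complex_of_real (v j) - of_real (a j) * s) * rGamma (of_real (w j) - of_real (a j) * s))"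
  define \<psi> where "\<psi> = (\<lambda>j s. Gamma (complex_of_real (\<omega> j) - of_real (\<Lambda> j) * s))"
  define X where "X = (\<lambda>s. (\<Prod>j\<in>{1..p'}. \<phi> j s) * ((\<Prod>j\<in>{1..k}. \<psi> j s) * Gamma s))"
  have Xi: "fox_Xi 1 (length as) as' bs' = X"
    unfolding as'_def bs'_def X_def \<phi>_def \<psi>_def as_def bs_def by (rule ext) (rule wright_Xi)
  have DI: "(v j, a j) \<in> D" if "j \<in> {1..p'}" for j using that by (auto simp: D_def)
  have DI': "(\<omega> j, \<Lambda> j) \<in> D" if "j \<in> {1..k}" for j using that by (auto simp: D_def)
  have nonpole: "complex_of_real \<alpha> - of_real A * s \<notin> \<int>\<^sub>\<le>\<^sub>0"
    if "s \<in> - complex_of_real ` (P \<union> Q)" "(\<alpha>, A) \<in> D" for s \<alpha> A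
    using that unfolding image_Un P_eq Q_eq by blast
  have nonpole': "s \<notin> \<int>\<^sub>\<le>\<^sub>0" if "s \<in> - complex_of_real ` (P \<union> Q)" for s :: complex
    using that unfolding image_Un P_eq by blast
  have holo: "X holomorphic_on - complex_of_real ` (P \<union> Q)"
    unfolding X_def \<phi>_def \<psi>_def
    by (intro holomorphic_intros nonpole nonpole' DI DI') assumption+
  have sb\<phi>: "strip_bounded (\<phi> j)" if "j \<in> {1..p'}" for j
  proof -
    have "strip_bounded (\<lambda>s. Gamma s * rGamma (s + of_real (w j - v j)))"
      using assms(3)[OF that] by (intro strip_bounded_Gamma_quotient) simp
    from strip_bounded_affine[OF this assms(1)[OF that], of "v j"] show ?thesis
      by (simp add: \<phi>_def algebra_simps)
  qed
  have sb\<psi>: "strip_bounded (\<psi> j)" if "j \<in> {1..k}" for j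
    unfolding \<psi>_def
    by (rule strip_bounded_affine[OF strip_bounded_Im_sqD[OF strip_bounded_Im_sq_Gamma] assms(7)[OF that]])
  have decay: "strip_bounded (\<lambda>s. of_real ((Im s)\<^sup>2) * (X s * of_real t powr (- s)))"
  proof -
    \<comment> \<open>All factors except Gamma(s) are collected here; they are bounded, and Gamma(s)
      alone supplies the quadratic decay.\<close>
    have "strip_bounded (\<lambda>s. ((\<Prod>j\<in>{1..p'}. \<phi> j s) * (\<Prod>j\<in>{1..k}. \<psi> j s)) * of_real t powr (- s))"
      using assms(9) by (intro strip_bounded_mult strip_bounded_prod strip_bounded_powr sb\<phi> sb\<psi>)
    from strip_bounded_Im_sq_Gamma_mult[OF this] show ?thesis
      by (simp add: X_def mult_ac)
  qed
  have W: "W = (\<integral>y. X (Complex \<sigma> y) * of_real t powr (- Complex \<sigma> y) \<partial>lborel) / (2 * pi)"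
  proof -
    have "W = fox_H 1 (length as) as' bs' t"
      by (simp add: W_def wright_W_def as_def bs_def as'_def bs'_def)
    also have "\<dots> = (\<integral>y. fox_Xi 1 (length as) as' bs' (Complex \<sigma> y) * of_real t powr (- Complex \<sigma> y) \<partial>lborel) / (2 * pi)"
      by (rule fox_H_eq_line_integral[OF left right closed fin Pless Qgr])
         (unfold Xi, assumption, assumption, intro holomorphic_intros holo, rule decay)
    finally show ?thesis unfolding Xi .
  qed
  \<comment> \<open>For Gamma alone the value at x is 2 \<pi> exp (- x); each further factor, being
    a positive superposition, preserves positivity.\<close>
  have base: "positive_Mellin_line Gamma \<sigma>"
    unfolding positive_Mellin_line_def
  proof (intro conjI allI impI)
    show "integrable lborel (\<lambda>y. Gamma (Complex \<sigma> y))"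
      using Gamma_Mellin_inversion(1)[OF \<sigma>0, of 1] by simp
    show "\<exists>r>0. (\<integral>y. Gamma (Complex \<sigma> y) * of_real x powr (- Complex \<sigma> y) \<partial>lborel) = complex_of_real r"
      if "x > 0" for x
      using Gamma_Mellin_inversion(2)[OF \<sigma>0 that] by (intro exI[of _ "2 * pi * exp (- x)"]) simp
  qed
  have "positive_Mellin_line X \<sigma>"
    unfolding X_def
  proof (intro positive_Mellin_line_prod base finite_atLeastAtMost)
    fix j assume j: "j \<in> {1..k}"
    show "positive_superposition (\<psi> j) (\<omega> j / \<Lambda> j)"
      unfolding \<psi>_def by (intro positive_superposition_Gamma assms(7) j)
    show "\<sigma> < \<omega> j / \<Lambda> j" using \<sigma> DI'[OF j] .
    then show "(\<lambda>y. \<psi> j (Complex \<sigma> y)) \<in> borel_measurable borel"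
      unfolding \<psi>_def by (intro borel_measurable_continuous_onI continuous_Gamma_affine_line assms(7) j)
  next
    fix j assume j: "j \<in> {1..p'}"
    show "positive_superposition (\<phi> j) (v j / a j)"
      unfolding \<phi>_def using assms(3)[OF j] by (intro positive_superposition_Beta assms(1) j) simp
    show \<sigma>j: "\<sigma> < v j / a j" using \<sigma> DI[OF j] .
    have "continuous_on UNIV (\<lambda>y. rGamma (complex_of_real (w j) - of_real (a j) * Complex \<sigma> y))"
      by (rule continuous_on_vertical_line[of _ UNIV]) (auto intro!: holomorphic_intros)
    then show "(\<lambda>y. \<phi> j (Complex \<sigma> y)) \<in> borel_measurable borel"
      unfolding \<phi>_def using \<sigma>j j
      by (intro borel_measurable_continuous_onI continuous_on_mult continuous_Gamma_affine_line assms(1))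
  qed
  then obtain r where r: "r > 0"
    "(\<integral>y. X (Complex \<sigma> y) * of_real t powr (- Complex \<sigma> y) \<partial>lborel) = complex_of_real r"
    using assms(9) by (auto simp: positive_Mellin_line_def)
  then have "W = of_real (r / (2 * pi))" by (simp add: W)
  moreover have "r / (2 * pi) > 0" using r(1) by simp
  ultimately show ?thesis by (simp only: Reals_of_real Re_complex_of_real simp_thms)
qed

end
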